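(* Let $p$ be an odd prime, let $G=\langle a,b,c \mid a^p=b^p=c^p=1,\ [a,b]=c,\ [c,a]=[c,b]=1\rangle$, and let $S=\{a^i,b^i\mid 1\leq i\leq p-1\}$. Then the Cayley graph $\mathrm{Cay}(G,S)$ is a $2$-distance-transitive normal Cayley graph that is neither distance-transitive nor $2$-arc-transitive.
   Context: All graphs are finite, simple and undirected; $V(\Gamma)$ and $\mathrm{Aut}(\Gamma)$ denote the vertex set and full automorphism group of a graph $\Gamma$. Here $[x,y]=x^{-1}y^{-1}xy$. For a finite group $G$ and $S\subseteq G\setminus\{1\}$ with $S=S^{-1}$, the Cayley graph $\mathrm{Cay}(G,S)$ has vertex set $G$, with $g,h$ adjacent if and only if $hg^{-1}\in S$. For $g\in G$ let $R(g)$ be the permutation $x\mapsto xg$ of $G$, and $R(G)=\{R(g)\mid g\in G\}$, a regular subgroup of $\mathrm{Aut}(\mathrm{Cay}(G,S))$. The Cayley graph $\Gamma=\mathrm{Cay}(G,S)$ is called normal if $R(G)$ is a normal subgroup of $\mathrm{Aut}(\Gamma)$. Let $d(u,v)$ be the usual graph distance. A graph $\Gamma$ is distance-transitive if for any vertices $u,v,x,y$ with $d(u,v)=d(x,y)$ there is $g\in\mathrm{Aut}(\Gamma)$ with $(u,v)^g=(x,y)$. A graph $\Gamma$ is $t$-distance-transitive if for each $1\le i\le t$ the group $\mathrm{Aut}(\Gamma)$ is transitive on the ordered pairs $(u,v)$ of vertices with $d(u,v)=i$. An $s$-arc of $\Gamma$ is a sequence $v_0,v_1,\dots,v_s$ of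 vertices such that $v_{i-1},v_i$ are adjacent for $1\le i\le s$ and $v_{i-1}\neq v_{i+1}$ for $1\le i\le s-1$. $\Gamma$ is $s$-arc-transitive if it has at least one $s$-arc and $\mathrm{Aut}(\Gamma)$ is transitive on the set of $s$-arcs of $\Gamma$. *)

theory Defs
  imports
    "HOL-Computational_Algebra.Primes"
    "HOL-Algebra.Coset"
    "HOL-Algebra.Bij"
    "Graph_Theory.Pair_Digraph"
    "Graph_Theory.Shortest_Path"
begin

section \<open>Group presentations\<close>

text \<open>
  A letter \<open>(x, True)\<close> stands for the generator \<open>x\<close>, and \<open>(x, False)\<close> for its
  formal inverse. The free group on the type \<open>'x\<close> consists of the words modulo insertion and
  deletion of adjacent mutually inverse letters.
\<close>

type_synonym 'x word = "('x \<times> bool) list"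

definition cancel :: "'x word rel" where
  "cancel = {(u @ [(x, e), (x, \<not> e)] @ v, u @ v) | u v x e. True}"

definition free_rel :: "'x word rel" where
  "free_rel = (cancel \<union> cancel\<inverse>)\<^sup>*"

definition free_group :: "'x word set monoid" where
  "free_group =
    \<lparr>carrier = UNIV // free_rel,
     mult = (\<lambda>A B. \<Union>u\<in>A. \<Union>v\<in>B. free_rel `` {u @ v}),
     one = free_rel `` {[]}\<rparr>"

definition free_gen :: "'x \<Rightarrow> 'x word set" where
  "free_gen x = free_rel `` {[(x, True)]}"

text \<open>A pair \<open>(u, v)\<close> in a set of relations stands for the relation \<open>u = v\<close>.\<close>

definition relation_subgroup :: "('x word set \<times> 'x word set) set \<Rightarrow> 'x word set set" where
  "relation_subgroup Rel =
    (\<lambda>N. N \<lhd> free_group) hull {u \<otimes>\<^bsub>free_group\<^esub> inv\<^bsub>free_group\<^esub> v | u v. (u, v) \<in> Rel}"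

definition presented_group ::
    "('x word set \<times> 'x word set) set \<Rightarrow> 'x word set set monoid" where
  "presented_group Rel = free_group Mod relation_subgroup Rel"

definition presented_gen ::
    "('x word set \<times> 'x word set) set \<Rightarrow> 'x \<Rightarrow> 'x word set set" where
  "presented_gen Rel x = relation_subgroup Rel #>\<^bsub>free_group\<^esub> free_gen x"

lemma free_rel_equiv: "equiv UNIV free_rel"
  unfolding free_rel_def
  by (intro equivI refl_rtrancl sym_rtrancl trans_rtrancl sym_Un_converse) simp

lemma free_rel_append:
  assumes "(u, u') \<in> free_rel" "(v, v') \<in> free_rel"
  shows "(u @ v, u' @ v') \<in> free_rel"
proof -
  have ctxt: "(w @ y @ w', w @ z @ w') \<in> cancel" if yz: "(y, z) \<in> cancel" for y z w w' :: "'a word"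
  proof -
    obtain s t x e where "y = s @ [(x, e), (x, \<not> e)] @ t" "z = s @ t"
      using yz unfolding cancel_def by auto
    then have "w @ y @ w' = (w @ s) @ [(x, e), (x, \<not> e)] @ (t @ w')" "w @ z @ w' = (w @ s) @ (t @ w')"
      by simp_all
    then show ?thesis
      unfolding cancel_def by blast
  qed
  have right: "(y @ w', z @ w') \<in> cancel \<union> cancel\<inverse>" if "(y, z) \<in> cancel \<union> cancel\<inverse>"
    for y z w' :: "'a word"
    using that ctxt[of y z "[]" w'] ctxt[of z y "[]" w'] by (simp only: append_Nil) blast
  have left: "(w @ y, w @ z) \<in> cancel \<union> cancel\<inverse>" if "(y, z) \<in> cancel \<union> cancel\<inverse>"
    for y z w :: "'a word"
    using that ctxt[of y z w "[]"] ctxt[of z y w "[]"] by (simp only: append_Nil2) blast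
  have "(u @ v, u' @ v) \<in> (cancel \<union> cancel\<inverse>)\<^sup>*"
    using assms(1)[unfolded free_rel_def]
  proof (induction rule: rtrancl_induct)
    case (step y z)
    show ?case by (rule rtrancl_into_rtrancl[OF step.IH right[OF step.hyps(2)]])
  qed (rule rtrancl.rtrancl_refl)
  moreover have "(u' @ v, u' @ v') \<in> (cancel \<union> cancel\<inverse>)\<^sup>*"
    using assms(2)[unfolded free_rel_def]
  proof (induction rule: rtrancl_induct)
    case (step y z)
    show ?case by (rule rtrancl_into_rtrancl[OF step.IH left[OF step.hyps(2)]])
  qed (rule rtrancl.rtrancl_refl)
  ultimately show ?thesis
    unfolding free_rel_def by (rule rtrancl_trans)
qed

lemma free_mult_class:
  "free_rel `` {u} \<otimes>\<^bsub>free_group\<^esub> free_rel `` {v} = free_rel `` {u @ v}"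
proof -
  have "free_rel `` {u' @ v'} = free_rel `` {u @ v}"
    if "u' \<in> free_rel `` {u}" "v' \<in> free_rel `` {v}" for u' v' :: "'a word"
    using that equiv_class_eq[OF free_rel_equiv free_rel_append[of u u' v v']] by simp
  moreover have "u \<in> free_rel `` {u}" "v \<in> free_rel `` {v}"
    by (simp_all add: free_rel_def)
  ultimately have "(\<Union>u'\<in>free_rel `` {u}. \<Union>v'\<in>free_rel `` {v}. free_rel `` {u' @ v'}) =
      free_rel `` {u @ v}"
    by blast
  then show ?thesis
    by (simp add: free_group_def)
qed

lemma free_rel_inverse:
  "(rev (map (\<lambda>(x, e). (x, \<not> e)) w) @ w, []) \<in> free_rel"
proof (induction w)
  case Nil
  show ?case by (simp add: free_rel_def)
next
  case (Cons l w)
  obtain x e where l: "l = (x, e)" by (cases l)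
  let ?r = "rev (map (\<lambda>(x, e). (x, \<not> e)) w)"
  have "(?r @ [(x, \<not> e), (x, \<not> \<not> e)] @ w, ?r @ w) \<in> cancel"
    unfolding cancel_def by blast
  then have "(?r @ [(x, \<not> e), (x, e)] @ w, ?r @ w) \<in> free_rel"
    unfolding free_rel_def not_not by (intro r_into_rtrancl UnI1)
  from rtrancl_trans[OF this[unfolded free_rel_def] Cons.IH[unfolded free_rel_def]]
  show ?case
    by (simp add: free_rel_def l)
qed

lemma group_free_group: "group (free_group :: 'x word set monoid)"
proof (rule groupI)
  let ?c = "\<lambda>w :: 'x word. free_rel `` {w}"
  have carr: "carrier free_group = range ?c"
    by (auto simp: free_group_def quotient_def)
  have one: "\<one>\<^bsub>free_group\<^esub> = ?c []"
    by (simp add: free_group_def)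
  fix x y z :: "'x word set"
  show "\<one>\<^bsub>free_group\<^esub> \<in> carrier (free_group :: 'x word set monoid)"
    by (auto simp: carr one)
  assume x: "x \<in> carrier free_group"
  then obtain w where w: "x = ?c w" by (auto simp: carr)
  show "\<one>\<^bsub>free_group\<^esub> \<otimes>\<^bsub>free_group\<^esub> x = x"
    by (simp add: w one free_mult_class)
  show "\<exists>y\<in>carrier free_group. y \<otimes>\<^bsub>free_group\<^esub> x = \<one>\<^bsub>free_group\<^esub>"
    using equiv_class_eq[OF free_rel_equiv free_rel_inverse, of w]
    by (auto simp: carr w one free_mult_class)
  assume y: "y \<in> carrier free_group"
  show "x \<otimes>\<^bsub>free_group\<^esub> y \<in> carrier free_group"
    using x y by (auto simp: carr free_mult_class)
  assume z: "z \<in> carrier free_group"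
  show "x \<otimes>\<^bsub>free_group\<^esub> y \<otimes>\<^bsub>free_group\<^esub> z = x \<otimes>\<^bsub>free_group\<^esub> (y \<otimes>\<^bsub>free_group\<^esub> z)"
    using x y z by (auto simp: carr free_mult_class)
qed

section \<open>Graphs, automorphisms and transitivity\<close>

text \<open>
  A finite simple undirected graph is a \<open>pair_graph\<close>: a symmetric loop-free set of ordered
  pairs on a finite vertex set.
\<close>

definition graph_auts :: "'a pair_pre_digraph \<Rightarrow> ('a \<Rightarrow> 'a) set" where
  "graph_auts \<Gamma> = {f \<in> Bij (pverts \<Gamma>).
     \<forall>u\<in>pverts \<Gamma>. \<forall>v\<in>pverts \<Gamma>. (f u, f v) \<in> parcs \<Gamma> \<longleftrightarrow> (u, v) \<in> parcs \<Gamma>}"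

definition graph_aut_group :: "'a pair_pre_digraph \<Rightarrow> ('a \<Rightarrow> 'a) monoid" where
  "graph_aut_group \<Gamma> = BijGroup (pverts \<Gamma>) \<lparr>carrier := graph_auts \<Gamma>\<rparr>"

text \<open>Every arc has weight \<open>1\<close>; vertices in different components are at distance \<open>\<infinity>\<close>.\<close>

definition graph_dist :: "'a pair_pre_digraph \<Rightarrow> 'a \<Rightarrow> 'a \<Rightarrow> ereal" where
  "graph_dist \<Gamma> u v = wf_digraph.\<mu> (with_proj \<Gamma>) (\<lambda>_. 1) u v"

definition distance_transitive :: "'a pair_pre_digraph \<Rightarrow> bool" where
  "distance_transitive \<Gamma> \<longleftrightarrow>
    (\<forall>u\<in>pverts \<Gamma>. \<forall>v\<in>pverts \<Gamma>. \<forall>x\<in>pverts \<Gamma>. \<forall>y\<in>pverts \<Gamma>.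
      graph_dist \<Gamma> u v = graph_dist \<Gamma> x y \<longrightarrow> (\<exists>f\<in>graph_auts \<Gamma>. f u = x \<and> f v = y))"

definition t_distance_transitive :: "nat \<Rightarrow> 'a pair_pre_digraph \<Rightarrow> bool" where
  "t_distance_transitive t \<Gamma> \<longleftrightarrow>
    (\<forall>i\<in>{1..t}.
      \<forall>u\<in>pverts \<Gamma>. \<forall>v\<in>pverts \<Gamma>. \<forall>x\<in>pverts \<Gamma>. \<forall>y\<in>pverts \<Gamma>.
        graph_dist \<Gamma> u v = ereal (real i) \<and> graph_dist \<Gamma> x y = ereal (real i) \<longrightarrow>
        (\<exists>f\<in>graph_auts \<Gamma>. f u = x \<and> f v = y))"

definition s_arcs :: "nat \<Rightarrow> 'a pair_pre_digraph \<Rightarrow> 'a list set" where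
  "s_arcs s \<Gamma> = {vs. length vs = s + 1 \<and> set vs \<subseteq> pverts \<Gamma> \<and>
     (\<forall>i\<in>{1..s}. (vs ! (i - 1), vs ! i) \<in> parcs \<Gamma>) \<and>
     (\<forall>i\<in>{1..s - 1}. vs ! (i - 1) \<noteq> vs ! (i + 1))}"

definition s_arc_transitive :: "nat \<Rightarrow> 'a pair_pre_digraph \<Rightarrow> bool" where
  "s_arc_transitive s \<Gamma> \<longleftrightarrow>
    s_arcs s \<Gamma> \<noteq> {} \<and>
    (\<forall>vs\<in>s_arcs s \<Gamma>. \<forall>ws\<in>s_arcs s \<Gamma>. \<exists>f\<in>graph_auts \<Gamma>. map f vs = ws)"

section \<open>Cayley graphs\<close>

definition cayley_graph :: "('a, 'b) monoid_scheme \<Rightarrow> 'a set \<Rightarrow> 'a pair_pre_digraph" where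
  "cayley_graph G S =
    \<lparr>pverts = carrier G,
     parcs = {(g, h). g \<in> carrier G \<and> h \<in> carrier G \<and> h \<otimes>\<^bsub>G\<^esub> inv\<^bsub>G\<^esub> g \<in> S}\<rparr>"

text \<open>The conditions on \<open>G\<close> and \<open>S\<close> under which \<open>Cay(G, S)\<close> is defined.\<close>

definition connection_set :: "('a, 'b) monoid_scheme \<Rightarrow> 'a set \<Rightarrow> bool" where
  "connection_set G S \<longleftrightarrow>
    group G \<and> finite (carrier G) \<and> S \<subseteq> carrier G - {\<one>\<^bsub>G\<^esub>} \<and> (\<lambda>s. inv\<^bsub>G\<^esub> s) ` S = S"

lemma pair_graph_cayley_graph:
  assumes "connection_set G S"
  shows "pair_graph (cayley_graph G S)"
proof -
  interpret group G using assms by (simp add: connection_set_def)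
  have fin: "finite (carrier G)" and sub: "S \<subseteq> carrier G - {\<one>\<^bsub>G\<^esub>}"
    and invS: "\<And>s. s \<in> S \<Longrightarrow> inv\<^bsub>G\<^esub> s \<in> S"
    using assms by (auto simp: connection_set_def)
  have "finite (parcs (cayley_graph G S))"
    by (rule finite_subset[of _ "carrier G \<times> carrier G"]) (auto simp: cayley_graph_def fin)
  moreover have "(h, g) \<in> parcs (cayley_graph G S)" if "(g, h) \<in> parcs (cayley_graph G S)" for g h
    using that invS[of "h \<otimes>\<^bsub>G\<^esub> inv\<^bsub>G\<^esub> g"] by (auto simp: cayley_graph_def inv_mult_group)
  ultimately show ?thesis
    using fin sub
    by unfold_locales (auto simp: cayley_graph_def symmetric_def sym_def)
qed

text \<open>
  Right translations, as elements of \<open>BijGroup (carrier G)\<close>. The product there is composition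
  of maps applied from the right, so \<open>right_translation G\<close> reverses products; its image is
  nevertheless the same subgroup.
\<close>

definition right_translation :: "('a, 'b) monoid_scheme \<Rightarrow> 'a \<Rightarrow> 'a \<Rightarrow> 'a" where
  "right_translation G g = (\<lambda>x\<in>carrier G. x \<otimes>\<^bsub>G\<^esub> g)"

definition normal_cayley_graph :: "('a, 'b) monoid_scheme \<Rightarrow> 'a set \<Rightarrow> bool" where
  "normal_cayley_graph G S \<longleftrightarrow>
    connection_set G S \<and>
    right_translation G ` carrier G \<lhd> graph_aut_group (cayley_graph G S)"

section \<open>The group and the connection set\<close>

definition commutator :: "('a, 'b) monoid_scheme \<Rightarrow> 'a \<Rightarrow> 'a \<Rightarrow> 'a" where
  "commutator G x y = inv\<^bsub>G\<^esub> x \<otimes>\<^bsub>G\<^esub> inv\<^bsub>G\<^esub> y \<otimes>\<^bsub>G\<^esub> x \<otimes>\<^bsub>G\<^esub> y"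

datatype gen = Gen_a | Gen_b | Gen_c

definition heis_relations :: "nat \<Rightarrow> (gen word set \<times> gen word set) set" where
  "heis_relations p =
    (let F = free_group; a = free_gen Gen_a; b = free_gen Gen_b; c = free_gen Gen_c in
     {(a [^]\<^bsub>F\<^esub> p, \<one>\<^bsub>F\<^esub>), (b [^]\<^bsub>F\<^esub> p, \<one>\<^bsub>F\<^esub>), (c [^]\<^bsub>F\<^esub> p, \<one>\<^bsub>F\<^esub>),
      (commutator F a b, c), (commutator F c a, \<one>\<^bsub>F\<^esub>), (commutator F c b, \<one>\<^bsub>F\<^esub>)})"

definition heis_group :: "nat \<Rightarrow> gen word set set monoid" where
  "heis_group p = presented_group (heis_relations p)"

definition heis_connection_set :: "nat \<Rightarrow> gen word set set set" where
  "heis_connection_set p =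
    (let G = heis_group p;
         a = presented_gen (heis_relations p) Gen_a;
         b = presented_gen (heis_relations p) Gen_b in
     {a [^]\<^bsub>G\<^esub> i | i. i \<in> {1..p - 1}} \<union> {b [^]\<^bsub>G\<^esub> i | i. i \<in> {1..p - 1}})"

end

theory Submission
  imports Defs "HOL-Number_Theory.Cong"
begin

text \<open>
  In the normal form \<open>b\<^sup>y a\<^sup>x c\<^sup>z\<close> the group becomes the set of triples \<open>(x, y, z)\<close> modulo \<open>p\<close>
  with product \<open>(x + x', y + y', z + z' + x y')\<close>. Two elements are adjacent iff they are distinct and
  lie on a common line, i.e. a common coset of \<open>\<langle>a\<rangle>\<close> or of \<open>\<langle>b\<rangle>\<close>. Each point is on one line of
  each type and two lines share at most one point, so the lines are recognised by triangles, and by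
  connectedness an automorphism either preserves or exchanges the two types. After composing with
  the group automorphism exchanging \<open>a\<close> and \<open>b\<close>, an automorphism fixing the identity preserves
  both types; incidence then forces it to be \<open>(x, y, z) \<mapsto> (A x, B y, H z)\<close> with
  \<open>H (z + x y) = H z + A x \<cdot> B y\<close>, hence a group automorphism. This gives normality, and a count of
  vanishing coordinates separates two elements at distance 3 from the identity. Conversely the maps
  \<open>(x, y, z) \<mapsto> (i x, j y, i j z)\<close> and the exchange act transitively on the spheres of
  radius 1 and 2.
\<close>

section \<open>Homomorphisms out of a presented group\<close>

text \<open>The relations bound the group only from above: they let every word be collected into a
  normal form, but do not show that different exponent triples give different elements. That half
  comes from checking the relations in an explicit group on triples and mapping the presented group
  to it. The locale \<open>heis_coordinates\<close> records the outcome with integer exponents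
  compared modulo \<open>p\<close>, so that no residues have to be normalised. Primality makes
  nonzero classes invertible, which decides when two lines have a common transversal. Oddness says
  that \<open>2\<close> is nonzero modulo \<open>p\<close>: it gives a third point on each line and
  separates \<open>1\<close> from \<open>-1\<close> when elements at distance 3 are compared. For
  \<open>p = 2\<close> the graph is a cycle of length 8, where both negative claims fail.\<close>

lemma relation_subgroup_normal:
  assumes "Rel \<subseteq> carrier free_group \<times> carrier free_group"
  shows "relation_subgroup Rel \<lhd> free_group"
proof -
  interpret F: group free_group by (rule group_free_group)
  let ?R = "{u \<otimes>\<^bsub>free_group\<^esub> inv\<^bsub>free_group\<^esub> v |u v. (u, v) \<in> Rel}"
  let ?T = "{N. N \<lhd> free_group \<and> ?R \<subseteq> N}"
  have hull: "relation_subgroup Rel = \<Inter>?T"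
    unfolding relation_subgroup_def hull_def by simp
  have "carrier free_group \<lhd> free_group"
    by (simp add: F.normal_inv_iff F.subgroup_self)
  moreover have "?R \<subseteq> carrier free_group"
    using assms by blast
  \<comment> \<open>The intersection of an empty family would be the whole type, hence the need for
    one member; the hypothesis on \<open>Rel\<close> provides it by keeping the relators inside the
    carrier.\<close>
  ultimately have "?T \<noteq> {}" by blast
  then have "subgroup (\<Inter>?T) free_group"
    by (intro F.subgroups_Inter) (auto intro: normal_imp_subgroup)
  moreover have "x \<otimes>\<^bsub>free_group\<^esub> h \<otimes>\<^bsub>free_group\<^esub> inv\<^bsub>free_group\<^esub> x \<in> \<Inter>?T"
    if "x \<in> carrier free_group" "h \<in> \<Inter>?T" for x h
    using that by (auto intro: normal.inv_op_closed2)
  ultimately show ?thesis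
    unfolding hull by (simp add: F.normal_inv_iff)
qed

lemma relation_subgroup_relator:
  assumes "(u, v) \<in> Rel"
  shows "u \<otimes>\<^bsub>free_group\<^esub> inv\<^bsub>free_group\<^esub> v \<in> relation_subgroup Rel"
  unfolding relation_subgroup_def using assms
  by (intro subsetD[OF hull_subset]) blast

lemma relation_subgroup_least:
  assumes "N \<lhd> free_group"
    and "\<And>u v. (u, v) \<in> Rel \<Longrightarrow> u \<otimes>\<^bsub>free_group\<^esub> inv\<^bsub>free_group\<^esub> v \<in> N"
  shows "relation_subgroup Rel \<subseteq> N"
  unfolding relation_subgroup_def using assms by (intro hull_minimal) auto

lemma group_presented_group:
  assumes "Rel \<subseteq> carrier free_group \<times> carrier free_group"
  shows "group (presented_group Rel)"
  unfolding presented_group_def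
  by (rule normal.factorgroup_is_group[OF relation_subgroup_normal[OF assms]])

lemma presented_projection_hom:
  assumes "Rel \<subseteq> carrier free_group \<times> carrier free_group"
  shows "group_hom free_group (presented_group Rel)
    (\<lambda>w. relation_subgroup Rel #>\<^bsub>free_group\<^esub> w)"
  unfolding group_hom_def group_hom_axioms_def presented_group_def
  using group_free_group group_presented_group[OF assms, unfolded presented_group_def]
    normal.r_coset_hom_Mod[OF relation_subgroup_normal[OF assms]] by blast

lemma presented_relation:
  assumes Rel: "Rel \<subseteq> carrier free_group \<times> carrier free_group" and uv: "(u, v) \<in> Rel"
  shows "relation_subgroup Rel #>\<^bsub>free_group\<^esub> u = relation_subgroup Rel #>\<^bsub>free_group\<^esub> v"
proof -
  interpret F: group free_group by (rule group_free_group)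
  have "u \<in> carrier free_group" "v \<in> carrier free_group" using assms by auto
  moreover have "subgroup (relation_subgroup Rel) free_group"
    by (rule normal_imp_subgroup[OF relation_subgroup_normal[OF Rel]])
  ultimately show ?thesis
    using F.coset_join2[OF _ _ relation_subgroup_relator[OF uv]]
      F.coset_mult_assoc[of "relation_subgroup Rel" "u \<otimes>\<^bsub>free_group\<^esub> inv\<^bsub>free_group\<^esub> v" v]
    by (simp add: F.m_assoc subgroup.subset)
qed

lemma free_class_in_carrier: "free_rel `` {w} \<in> carrier free_group"
  by (auto simp: free_group_def quotient_def)

lemma free_gen_in_carrier: "free_gen x \<in> carrier free_group"
  by (simp add: free_gen_def free_class_in_carrier)

lemma inv_free_gen: "inv\<^bsub>free_group\<^esub> (free_gen x) = free_rel `` {[(x, False)]}"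
proof (rule group.inv_equality[OF group_free_group])
  have "free_rel `` {[(x, False), (x, True)]} = free_rel `` {[]}"
    using equiv_class_eq[OF free_rel_equiv free_rel_inverse[of "[(x, True)]"]] by simp
  then show "free_rel `` {[(x, False)]} \<otimes>\<^bsub>free_group\<^esub> free_gen x = \<one>\<^bsub>free_group\<^esub>"
    by (simp add: free_gen_def free_mult_class) (simp add: free_group_def)
qed (simp_all add: free_class_in_carrier free_gen_in_carrier)

text \<open>Every element is the class of a word, and words grow by letters on the left. This is how
  the normal forms are shown to exhaust the group.\<close>

lemma free_group_induct [consumes 1, case_names one gen inv_gen]:
  assumes "A \<in> carrier free_group"
    and one: "P \<one>\<^bsub>free_group\<^esub>"
    and gen: "\<And>x B. B \<in> carrier free_group \<Longrightarrow> P B \<Longrightarrow> P (free_gen x \<otimes>\<^bsub>free_group\<^esub> B)"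
    and inv_gen: "\<And>x B. B \<in> carrier free_group \<Longrightarrow> P B \<Longrightarrow>
      P (inv\<^bsub>free_group\<^esub> (free_gen x) \<otimes>\<^bsub>free_group\<^esub> B)"
  shows "P A"
proof -
  have "P (free_rel `` {w})" for w
  proof (induction w)
    case Nil
    show ?case using one by (simp add: free_group_def)
  next
    case (Cons l w)
    obtain x e where l: "l = (x, e)" by (cases l)
    show ?case
      using gen[OF free_class_in_carrier Cons.IH, of x]
        inv_gen[OF free_class_in_carrier Cons.IH, of x]
      unfolding inv_free_gen
      unfolding free_gen_def free_mult_class by (cases e) (simp_all add: l)
  qed
  then show ?thesis using assms(1) by (auto simp: free_group_def quotient_def)
qed

lemma (in group) mult_inv_cancel_left:
  "x \<in> carrier G \<Longrightarrow> y \<in> carrier G \<Longrightarrow> x \<otimes> (inv x \<otimes> y) = y"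
  by (simp flip: m_assoc)

text \<open>Existence half of the universal property: evaluation of words in \<open>H\<close> is
  unchanged by inserting or deleting a pair of inverse letters, so it descends to classes.\<close>

lemma free_group_hom_exists:
  assumes H: "group H" and \<gamma>: "\<And>x. \<gamma> x \<in> carrier H"
  obtains \<phi> where "\<phi> \<in> hom free_group H" "\<And>x. \<phi> (free_gen x) = \<gamma> x"
proof -
  interpret H: group H by (rule H)
  define ev where "ev w = foldr (\<lambda>(x, e) g. (if e then \<gamma> x else inv\<^bsub>H\<^esub> \<gamma> x) \<otimes>\<^bsub>H\<^esub> g) w \<one>\<^bsub>H\<^esub>" for w
  have ev_simps: "ev [] = \<one>\<^bsub>H\<^esub>"
    "ev ((x, e) # w) = (if e then \<gamma> x else inv\<^bsub>H\<^esub> \<gamma> x) \<otimes>\<^bsub>H\<^esub> ev w" for x e w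
    by (simp_all add: ev_def)
  have ev_closed [simp]: "ev w \<in> carrier H" for w
    by (induction w) (auto simp: ev_simps \<gamma>)
  have ev_append: "ev (u @ v) = ev u \<otimes>\<^bsub>H\<^esub> ev v" for u v
    by (induction u) (auto simp: ev_simps \<gamma> H.m_assoc)
  have "ev u = ev v" if "(u, v) \<in> cancel" for u v
    using that unfolding cancel_def
    by (auto simp: ev_append ev_simps \<gamma> H.inv_solve_left' H.m_assoc H.mult_inv_cancel_left)
  then have ev_step: "ev u = ev v" if "(u, v) \<in> cancel \<union> cancel\<inverse>" for u v
    using that by auto
  have ev_rel: "ev u = ev v" if "(u, v) \<in> free_rel" for u v
    using that unfolding free_rel_def
    by (induction rule: rtrancl_induct) (metis ev_step)+
  define \<phi> where "\<phi> A = ev (SOME w. w \<in> A)" for A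
  have \<phi>_class: "\<phi> (free_rel `` {w}) = ev w" for w
  proof -
    have "(SOME v. v \<in> free_rel `` {w}) \<in> free_rel `` {w}"
      by (rule someI[of _ w]) (simp add: free_rel_def)
    then show ?thesis unfolding \<phi>_def using ev_rel by auto
  qed
  have carr: "carrier free_group = range (\<lambda>w. free_rel `` {w})"
    by (auto simp: free_group_def quotient_def)
  show ?thesis
  proof
    show "\<phi> \<in> hom free_group H"
      by (rule homI) (auto simp: carr free_mult_class \<phi>_class ev_append)
    show "\<phi> (free_gen x) = \<gamma> x" for x
      by (simp add: free_gen_def \<phi>_class ev_simps \<gamma>)
  qed
qed

text \<open>Von Dyck's theorem: the kernel of \<phi> is normal and contains the relators, hence
  contains their normal closure, so \<phi> factors through the quotient.\<close>

lemma presented_group_hom_exists: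
  assumes H: "group H" and \<phi>: "\<phi> \<in> hom free_group H"
    and Rel: "Rel \<subseteq> carrier free_group \<times> carrier free_group"
    and relations: "\<And>u v. (u, v) \<in> Rel \<Longrightarrow> \<phi> u = \<phi> v"
  obtains \<Phi> where "\<Phi> \<in> hom (presented_group Rel) H"
    "\<And>x. \<Phi> (presented_gen Rel x) = \<phi> (free_gen x)"
proof -
  interpret group_hom free_group H \<phi>
    using H \<phi> group_free_group by (simp add: group_hom_def group_hom_axioms_def)
  have "relation_subgroup Rel \<subseteq> kernel free_group H \<phi>"
  proof (rule relation_subgroup_least[OF normal_kernel])
    fix u v assume "(u, v) \<in> Rel"
    moreover from this have "u \<in> carrier free_group" "v \<in> carrier free_group"
      using Rel by auto
    ultimately show "u \<otimes>\<^bsub>free_group\<^esub> inv\<^bsub>free_group\<^esub> v \<in> kernel free_group H \<phi>"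
      using relations by (simp add: kernel_def)
  qed
  from FactGroup_universal_kernel[OF relation_subgroup_normal[OF Rel] this]
  obtain \<Phi> where "\<Phi> \<in> hom (free_group Mod relation_subgroup Rel) H"
    "\<And>w. w \<in> carrier free_group \<Longrightarrow> \<Phi> (relation_subgroup Rel #>\<^bsub>free_group\<^esub> w) = \<phi> w"
    by metis
  then show thesis
    by (intro that[of \<Phi>]) (auto simp: presented_group_def presented_gen_def free_gen_in_carrier)
qed

section \<open>Coordinates on the Heisenberg group\<close>

text \<open>Reduces identities about integer powers to one additivity check, without a separate
  induction and sign distinction for each of them.\<close>

lemma (in group) additive_eq_int_pow:
  fixes f :: "int \<Rightarrow> 'a"
  assumes add: "\<And>i j. f (i + j) = f i \<otimes> f j" and closed: "\<And>i. f i \<in> carrier G"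
  shows "f i = f 1 [^] i"
proof -
  have zero: "f 0 = \<one>"
    using add[of 0 0] closed[of 0] by simp
  have nat: "f (int n) = f 1 [^] n" for n
  proof (induction n)
    case (Suc n)
    have "f (int n + 1) = f (int n) \<otimes> f 1" by (rule add)
    then show ?case using Suc by (simp add: add.commute)
  qed (simp add: zero)
  show ?thesis
  proof (cases i rule: int_cases2)
    case (nonneg n)
    then show ?thesis by (simp add: nat int_pow_int)
  next
    case (nonpos n)
    have "f (- int n) \<otimes> f (int n) = \<one>"
      by (simp flip: add add: zero)
    then have "inv (f (int n)) = f (- int n)"
      by (simp add: closed inv_equality)
    then show ?thesis
      by (simp add: nonpos int_pow_neg_int closed nat)
  qed
qed

lemma (in group) conj_int_pow:
  fixes n :: int
  assumes [simp]: "g \<in> carrier G" "h \<in> carrier G"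
  shows "inv g \<otimes> h [^] n \<otimes> g = (inv g \<otimes> h \<otimes> g) [^] n"
proof -
  have "inv g \<otimes> h [^] (i + j) \<otimes> g = (inv g \<otimes> h [^] i \<otimes> g) \<otimes> (inv g \<otimes> h [^] j \<otimes> g)"
    for i j :: int
    by (simp add: int_pow_mult m_assoc mult_inv_cancel_left)
  from additive_eq_int_pow[of "\<lambda>n. inv g \<otimes> h [^] n \<otimes> g", OF this]
  show ?thesis by simp
qed

lemma (in group) conj_fixed_iff:
  assumes "g \<in> carrier G" "h \<in> carrier G"
  shows "inv g \<otimes> h \<otimes> g = h \<longleftrightarrow> h \<otimes> g = g \<otimes> h"
  using assms by (simp add: m_assoc inv_solve_left')

text \<open>To commute is to be fixed under conjugation, and conjugation passes through powers. Used
  once for powers of \<open>h\<close> and once, with the roles exchanged, for powers of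
  \<open>g\<close>.\<close>

lemma (in group) int_pow_commute:
  fixes m n :: int
  assumes gh: "h \<otimes> g = g \<otimes> h" and [simp]: "g \<in> carrier G" "h \<in> carrier G"
  shows "h [^] m \<otimes> g [^] n = g [^] n \<otimes> h [^] m"
proof -
  have "inv g \<otimes> h [^] m \<otimes> g = h [^] m"
    using conj_fixed_iff[of g h] gh by (simp add: conj_int_pow)
  then have "inv (h [^] m) \<otimes> g \<otimes> h [^] m = g"
    using conj_fixed_iff[of g "h [^] m"] conj_fixed_iff[of "h [^] m" g] by simp
  then have "inv (h [^] m) \<otimes> g [^] n \<otimes> h [^] m = g [^] n"
    by (simp add: conj_int_pow)
  then show ?thesis
    using conj_fixed_iff[of "h [^] m" "g [^] n"] by simp
qed

lemma (in group) int_pow_eqI: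
  fixes i j :: int
  assumes "x \<in> carrier G" "x [^] n = \<one>" "[i = j] (mod int n)"
  shows "x [^] i = x [^] j"
proof -
  obtain k where "j = i + int n * k" using assms(3) by (auto simp: cong_iff_lin)
  then show ?thesis
    using assms(1,2) by (simp add: int_pow_mult int_pow_int flip: int_pow_pow)
qed

text \<open>Conjugation by \<open>b\<close> turns \<open>a\<close> into \<open>a c\<close>, hence
  \<open>a^x\<close> into \<open>a^x c^x\<close>. Read the other way, conjugation by
  \<open>a^x\<close> turns \<open>b c^x\<close> into \<open>b\<close>; taking \<open>y\<close>-th
  powers, with \<open>c\<close> commuting with \<open>b\<close>, gives the formula.\<close>

lemma (in group) heis_commutation:
  fixes x y :: int
  assumes [simp]: "a \<in> carrier G" "b \<in> carrier G" "c \<in> carrier G"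
    and ab: "a \<otimes> b = b \<otimes> a \<otimes> c" and ca: "c \<otimes> a = a \<otimes> c" and cb: "c \<otimes> b = b \<otimes> c"
  shows "a [^] x \<otimes> b [^] y = b [^] y \<otimes> a [^] x \<otimes> c [^] (x * y)"
proof -
  have cxb: "b \<otimes> c [^] x = c [^] x \<otimes> b"
    using int_pow_commute[OF cb, of x 1] by simp
  have cxa: "c [^] i \<otimes> a [^] x = a [^] x \<otimes> c [^] i" for i :: int
    using int_pow_commute[OF ca, of i x] by simp
  have "inv b \<otimes> a \<otimes> b = a \<otimes> c"
    using ab by (simp add: m_assoc inv_solve_left')
  then have "inv b \<otimes> a [^] x \<otimes> b = a [^] x \<otimes> c [^] x"
    by (simp add: conj_int_pow int_pow_mult_distrib ca)
  then have axb: "a [^] x \<otimes> b = b \<otimes> (a [^] x \<otimes> c [^] x)"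
    by (simp add: m_assoc inv_solve_left')
  have "inv (a [^] x) \<otimes> (b \<otimes> c [^] x) \<otimes> a [^] x = b"
    using axb cxa by (simp add: m_assoc inv_solve_left')
  then have "inv (a [^] x) \<otimes> (b [^] y \<otimes> c [^] (x * y)) \<otimes> a [^] x = b [^] y"
    using conj_int_pow[of "a [^] x" "b \<otimes> c [^] x" y] int_pow_mult_distrib[OF cxb, of y]
    by (simp add: int_pow_pow)
  then show ?thesis
    by (simp add: m_assoc inv_solve_left' cxa)
qed

text \<open>The unitriangular 3 by 3 matrices modulo \<open>p\<close>, with \<open>x\<close> and
  \<open>y\<close> next to the diagonal and \<open>z\<close> in the corner.\<close>

definition heis_model :: "nat \<Rightarrow> (int \<times> int \<times> int) monoid" where
  "heis_model p =
    \<lparr>carrier = {0..<int p} \<times> {0..<int p} \<times> {0..<int p},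
     mult = (\<lambda>(x, y, z) (x', y', z').
       ((x + x') mod int p, (y + y') mod int p, (z + z' + x * y') mod int p)),
     one = (0, 0, 0)\<rparr>"

lemma group_heis_model:
  assumes "p > 0"
  shows "group (heis_model p)"
proof (rule groupI)
  fix g assume "g \<in> carrier (heis_model p)"
  moreover obtain x y z where "g = (x, y, z)" by (cases g)
  moreover have "[(x * y - z) mod int p + z + - x mod int p * y = (x * y - z) + z + - x * y] (mod int p)"
    by (intro cong_add cong_mult) (auto simp: cong_def)
  ultimately show "\<exists>h\<in>carrier (heis_model p). h \<otimes>\<^bsub>heis_model p\<^esub> g = \<one>\<^bsub>heis_model p\<^esub>"
    using assms
    \<comment> \<open>The last entry cancels both \<open>z\<close> and the cocycle term
      \<open>(- x) * y\<close>.\<close>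
    by (intro bexI[of _ "((- x) mod int p, (- y) mod int p, (x * y - z) mod int p)"])
      (auto simp: heis_model_def mod_simps cong_def)
next
  fix g h k
  assume "g \<in> carrier (heis_model p)" "h \<in> carrier (heis_model p)" "k \<in> carrier (heis_model p)"
  obtain x y z x' y' z' x'' y'' z''
    where [simp]: "g = (x, y, z)" "h = (x', y', z')" "k = (x'', y'', z'')"
    by (cases g, cases h, cases k)
  have "[(z + z' + x * y') mod int p + z'' + (x + x') mod int p * y''
      = (z + z' + x * y') + z'' + (x + x') * y''] (mod int p)"
    "[z + (z' + z'' + x' * y'') mod int p + x * ((y' + y'') mod int p)
      = z + (z' + z'' + x' * y'') + x * (y' + y'')] (mod int p)"
    by (intro cong_add cong_mult; simp add: cong_def)+
  then show "g \<otimes>\<^bsub>heis_model p\<^esub> h \<otimes>\<^bsub>heis_model p\<^esub> k =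
      g \<otimes>\<^bsub>heis_model p\<^esub> (h \<otimes>\<^bsub>heis_model p\<^esub> k)"
    by (simp add: heis_model_def mod_simps cong_def algebra_simps)
qed (use assms in \<open>auto simp: heis_model_def\<close>)

text \<open>
  The triple \<open>(x, y, z)\<close> stands for \<open>b\<^sup>y a\<^sup>x c\<^sup>z\<close>. With this order of the factors the
  cocycle is \<open>x y'\<close>, left multiplication by \<open>b\<close> changes only \<open>y\<close>, and left
  multiplication by \<open>a\<close> preserves \<open>y\<close> and \<open>z - x y\<close>.
\<close>

locale heis_coordinates = group G for G (structure) +
  fixes p :: nat and e :: "int \<Rightarrow> int \<Rightarrow> int \<Rightarrow> 'a"
  assumes prime_p: "prime p" and odd_p: "odd p"
    and e_mult: "e x y z \<otimes> e x' y' z' = e (x + x') (y + y') (z + z' + x * y')"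
    and e_eq_iff: "e x y z = e x' y' z' \<longleftrightarrow>
      [x = x'] (mod int p) \<and> [y = y'] (mod int p) \<and> [z = z'] (mod int p)"
    and carrier_eq: "carrier G = {e x y z |x y z. True}"

section \<open>From the presentation to coordinates\<close>

lemma heis_relations_subset: "heis_relations p \<subseteq> carrier free_group \<times> carrier free_group"
proof -
  interpret F: group free_group by (rule group_free_group)
  show ?thesis
    by (auto simp: heis_relations_def Let_def commutator_def free_gen_in_carrier)
qed

text \<open>The entry is \<open>1 mod int p\<close> rather than \<open>1\<close> because
  \<open>p > 0\<close> admits \<open>p = 1\<close>, where \<open>1\<close> lies outside the
  carrier.\<close>

lemma heis_model_int_pow:
  fixes i :: int
  assumes "p > 0"
  shows "(1 mod int p, 0, 0) [^]\<^bsub>heis_model p\<^esub> i = (i mod int p, 0, 0)"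
    and "(0, 1 mod int p, 0) [^]\<^bsub>heis_model p\<^esub> i = (0, i mod int p, 0)"
    and "(0, 0, 1 mod int p) [^]\<^bsub>heis_model p\<^esub> i = (0, 0, i mod int p)"
proof -
  interpret group "heis_model p" by (rule group_heis_model[OF assms])
  show "(1 mod int p, 0, 0) [^]\<^bsub>heis_model p\<^esub> i = (i mod int p, 0, 0)"
    using assms
    by (intro additive_eq_int_pow[of "\<lambda>i. (i mod int p, 0, 0)", symmetric])
      (auto simp: heis_model_def mod_simps)
  show "(0, 1 mod int p, 0) [^]\<^bsub>heis_model p\<^esub> i = (0, i mod int p, 0)"
    using assms
    by (intro additive_eq_int_pow[of "\<lambda>i. (0, i mod int p, 0)", symmetric])
      (auto simp: heis_model_def mod_simps)
  show "(0, 0, 1 mod int p) [^]\<^bsub>heis_model p\<^esub> i = (0, 0, i mod int p)"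
    using assms
    by (intro additive_eq_int_pow[of "\<lambda>i. (0, 0, i mod int p)", symmetric])
      (auto simp: heis_model_def mod_simps)
qed

text \<open>The lower bound on the presented group: a homomorphism that remembers the exponents of a
  normal form modulo \<open>p\<close>.\<close>

lemma heis_model_hom_exists:
  assumes "p > 0"
  obtains \<Phi> where "\<Phi> \<in> hom (heis_group p) (heis_model p)"
    "\<Phi> (presented_gen (heis_relations p) Gen_a) = (1 mod int p, 0, 0)"
    "\<Phi> (presented_gen (heis_relations p) Gen_b) = (0, 1 mod int p, 0)"
    "\<Phi> (presented_gen (heis_relations p) Gen_c) = (0, 0, 1 mod int p)"
proof -
  let ?H = "heis_model p"
  interpret H: group ?H by (rule group_heis_model[OF assms])
  define \<gamma> where "\<gamma> x = (case x of Gen_a \<Rightarrow> (1 mod int p, 0, 0) | Gen_b \<Rightarrow> (0, 1 mod int p, 0)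
    | Gen_c \<Rightarrow> (0, 0, 1 mod int p))" for x
  have \<gamma>_closed: "\<gamma> x \<in> carrier ?H" for x
    using assms by (cases x) (auto simp: \<gamma>_def heis_model_def)
  obtain \<phi> where \<phi>: "\<phi> \<in> hom free_group ?H" and \<phi>_gen: "\<And>x. \<phi> (free_gen x) = \<gamma> x"
    using free_group_hom_exists[of ?H \<gamma>, OF H.group_axioms \<gamma>_closed] by blast
  interpret group_hom free_group ?H \<phi>
    using \<phi> group_free_group H.group_axioms by (simp add: group_hom_def group_hom_axioms_def)
  have pow: "\<gamma> x [^]\<^bsub>?H\<^esub> p = \<one>\<^bsub>?H\<^esub>" for x
    using heis_model_int_pow[OF assms, of "int p", unfolded int_pow_int]
    by (cases x) (simp_all add: \<gamma>_def heis_model_def)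
  \<comment> \<open>Writing a commutator relation as \<open>x y = y x k\<close> avoids computing
    inverses in the model.\<close>
  have \<phi>_commutator: "\<phi> (commutator free_group (free_gen x) (free_gen y)) = k"
    if "\<gamma> x \<otimes>\<^bsub>?H\<^esub> \<gamma> y = \<gamma> y \<otimes>\<^bsub>?H\<^esub> \<gamma> x \<otimes>\<^bsub>?H\<^esub> k" "k \<in> carrier ?H" for x y k
    using that by (simp add: commutator_def free_gen_in_carrier \<phi>_gen \<gamma>_closed H.m_assoc
        H.inv_solve_left')
  have "\<phi> (commutator free_group (free_gen Gen_a) (free_gen Gen_b)) = \<gamma> Gen_c"
    "\<phi> (commutator free_group (free_gen Gen_c) (free_gen Gen_a)) = \<one>\<^bsub>?H\<^esub>"
    "\<phi> (commutator free_group (free_gen Gen_c) (free_gen Gen_b)) = \<one>\<^bsub>?H\<^esub>"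
    by (intro \<phi>_commutator conjI; (simp add: \<gamma>_closed)?; simp add: \<gamma>_def heis_model_def mod_simps)+
  then have "\<phi> u = \<phi> v" if "(u, v) \<in> heis_relations p" for u v
    using that unfolding heis_relations_def Let_def
    by (auto simp: free_gen_in_carrier hom_nat_pow \<phi>_gen pow)
  from presented_group_hom_exists[OF H.group_axioms \<phi> heis_relations_subset this]
  obtain \<Phi> where "\<Phi> \<in> hom (heis_group p) ?H"
    and "\<And>x. \<Phi> (presented_gen (heis_relations p) x) = \<phi> (free_gen x)"
    unfolding heis_group_def by blast
  then show thesis
    by (intro that[of \<Phi>]) (simp_all add: \<phi>_gen \<gamma>_def)
qed

text \<open>The commutation rules make normal forms closed under products and inverses, so they fill
  the group. Exponents matter at most modulo \<open>p\<close> because the generators have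
  \<open>p\<close>-th power one, and at least modulo \<open>p\<close> because the homomorphism to
  the model sees them.\<close>

lemma heis_group_coordinates:
  assumes "prime p" "odd p"
  obtains e where "heis_coordinates (heis_group p) p e"
    "heis_connection_set p =
      {e i 0 0 |i. \<not> [i = 0] (mod int p)} \<union> {e 0 i 0 |i. \<not> [i = 0] (mod int p)}"
proof -
  let ?N = "relation_subgroup (heis_relations p)"
  define G where "G = heis_group p"
  have p: "p > 0" using assms(1) by (rule prime_gt_0_nat)
  have hom: "group_hom free_group G (\<lambda>w. ?N #>\<^bsub>free_group\<^esub> w)"
    unfolding G_def heis_group_def by (rule presented_projection_hom[OF heis_relations_subset])
  then interpret group_hom free_group G "\<lambda>w. ?N #>\<^bsub>free_group\<^esub> w" .
  define gen where "gen = presented_gen (heis_relations p)"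
  define a b c where "a = gen Gen_a" and "b = gen Gen_b" and "c = gen Gen_c"
  have gen_eq: "?N #>\<^bsub>free_group\<^esub> free_gen x = gen x" for x
    by (simp add: gen_def presented_gen_def)
  have [simp]: "gen x \<in> carrier G" for x
    by (simp flip: gen_eq add: free_gen_in_carrier)
  then have [simp]: "a \<in> carrier G" "b \<in> carrier G" "c \<in> carrier G"
    by (simp_all add: a_def b_def c_def)
  note relation = presented_relation[OF heis_relations_subset, of _ _ p]
  have pow: "gen x [^]\<^bsub>G\<^esub> p = \<one>\<^bsub>G\<^esub>" for x
  proof -
    have "(free_gen x [^]\<^bsub>free_group\<^esub> p, \<one>\<^bsub>free_group\<^esub>) \<in> heis_relations p"
      by (cases x) (simp_all add: heis_relations_def Let_def)
    from relation[OF this] show ?thesis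
      by (simp add: hom_nat_pow free_gen_in_carrier gen_eq)
  qed
  have commutator_rel: "gen x \<otimes>\<^bsub>G\<^esub> gen y = gen y \<otimes>\<^bsub>G\<^esub> gen x \<otimes>\<^bsub>G\<^esub> (?N #>\<^bsub>free_group\<^esub> k)"
    if "(commutator free_group (free_gen x) (free_gen y), k) \<in> heis_relations p"
      "k \<in> carrier free_group" for x y k
    using relation[OF that(1)] that(2)
    by (simp add: commutator_def free_gen_in_carrier gen_eq H.m_assoc H.inv_solve_left')
  have ab: "a \<otimes>\<^bsub>G\<^esub> b = b \<otimes>\<^bsub>G\<^esub> a \<otimes>\<^bsub>G\<^esub> c"
    unfolding a_def b_def c_def gen_eq[of Gen_c, symmetric]
    by (rule commutator_rel) (simp_all add: heis_relations_def Let_def free_gen_in_carrier)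
  have ca: "c \<otimes>\<^bsub>G\<^esub> a = a \<otimes>\<^bsub>G\<^esub> c" and cb: "c \<otimes>\<^bsub>G\<^esub> b = b \<otimes>\<^bsub>G\<^esub> c"
  proof -
    have "(commutator free_group (free_gen Gen_c) (free_gen Gen_a), \<one>\<^bsub>free_group\<^esub>) \<in> heis_relations p"
      "(commutator free_group (free_gen Gen_c) (free_gen Gen_b), \<one>\<^bsub>free_group\<^esub>) \<in> heis_relations p"
      by (simp_all add: heis_relations_def Let_def)
    from this[THEN commutator_rel]
    show "c \<otimes>\<^bsub>G\<^esub> a = a \<otimes>\<^bsub>G\<^esub> c" "c \<otimes>\<^bsub>G\<^esub> b = b \<otimes>\<^bsub>G\<^esub> c"
      by (simp_all add: a_def b_def c_def)
  qed
  define e where "e x y z = b [^]\<^bsub>G\<^esub> y \<otimes>\<^bsub>G\<^esub> (a [^]\<^bsub>G\<^esub> x \<otimes>\<^bsub>G\<^esub> c [^]\<^bsub>G\<^esub> z)" for x y z :: int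
  have [simp]: "e x y z \<in> carrier G" for x y z by (simp add: e_def)
  have e_mult: "e x y z \<otimes>\<^bsub>G\<^esub> e x' y' z' = e (x + x') (y + y') (z + z' + x * y')" for x y z x' y' z'
  proof -
    \<comment> \<open>Products are kept nested to the right, so each commutation rule is also needed
      with an arbitrary tail \<open>h\<close>.\<close>
    have left_commute: "u \<otimes>\<^bsub>G\<^esub> (v \<otimes>\<^bsub>G\<^esub> h) = v \<otimes>\<^bsub>G\<^esub> (w \<otimes>\<^bsub>G\<^esub> h)"
      if "u \<otimes>\<^bsub>G\<^esub> v = v \<otimes>\<^bsub>G\<^esub> w" "u \<in> carrier G" "v \<in> carrier G" "w \<in> carrier G" "h \<in> carrier G"
      for u v w h
      using that by (simp flip: H.m_assoc)
    have cb': "c [^]\<^bsub>G\<^esub> i \<otimes>\<^bsub>G\<^esub> (b [^]\<^bsub>G\<^esub> j \<otimes>\<^bsub>G\<^esub> h) = b [^]\<^bsub>G\<^esub> j \<otimes>\<^bsub>G\<^esub> (c [^]\<^bsub>G\<^esub> i \<otimes>\<^bsub>G\<^esub> h)"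
      and ca': "c [^]\<^bsub>G\<^esub> i \<otimes>\<^bsub>G\<^esub> (a [^]\<^bsub>G\<^esub> j \<otimes>\<^bsub>G\<^esub> h) = a [^]\<^bsub>G\<^esub> j \<otimes>\<^bsub>G\<^esub> (c [^]\<^bsub>G\<^esub> i \<otimes>\<^bsub>G\<^esub> h)"
      if "h \<in> carrier G" for i j :: int and h
      using that by (simp_all add: left_commute H.int_pow_commute ca cb)
    have ab': "a [^]\<^bsub>G\<^esub> x \<otimes>\<^bsub>G\<^esub> (b [^]\<^bsub>G\<^esub> y' \<otimes>\<^bsub>G\<^esub> h)
        = b [^]\<^bsub>G\<^esub> y' \<otimes>\<^bsub>G\<^esub> (a [^]\<^bsub>G\<^esub> x \<otimes>\<^bsub>G\<^esub> (c [^]\<^bsub>G\<^esub> (x * y') \<otimes>\<^bsub>G\<^esub> h))"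
      if "h \<in> carrier G" for h
      using that left_commute[of "a [^]\<^bsub>G\<^esub> x" "b [^]\<^bsub>G\<^esub> y'" "a [^]\<^bsub>G\<^esub> x \<otimes>\<^bsub>G\<^esub> c [^]\<^bsub>G\<^esub> (x * y')" h]
      by (simp add: H.heis_commutation[OF _ _ _ ab ca cb] H.m_assoc)
    have "c [^]\<^bsub>G\<^esub> (z + z' + x * y') = c [^]\<^bsub>G\<^esub> (x * y') \<otimes>\<^bsub>G\<^esub> (c [^]\<^bsub>G\<^esub> z \<otimes>\<^bsub>G\<^esub> c [^]\<^bsub>G\<^esub> z')"
      by (simp add: add.commute flip: H.int_pow_mult)
    then show ?thesis
      by (simp add: e_def H.m_assoc H.int_pow_mult[of a] H.int_pow_mult[of b] cb' ca' ab')
  qed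
  have inv_e: "inv\<^bsub>G\<^esub> (e x y z) = e (- x) (- y) (x * y - z)" for x y z
    by (rule H.inv_equality) (simp_all add: e_mult, simp add: e_def)
  have gen_e: "a = e 1 0 0" "b = e 0 1 0" "c = e 0 0 1"
    by (simp_all add: e_def)
  have range: "w \<in> {e x y z |x y z. True}" if "w \<in> carrier G" for w
  proof -
    let ?E = "{e x y z |x y z. True}"
    have mult_range: "g \<otimes>\<^bsub>G\<^esub> h \<in> ?E" if "g \<in> ?E" "h \<in> ?E" for g h
      using that e_mult by blast
    have gen_range: "gen x \<in> ?E" "inv\<^bsub>G\<^esub> (gen x) \<in> ?E" for x
    proof -
      have "gen x \<in> {e 1 0 0, e 0 1 0, e 0 0 1}"
        by (cases x) (simp_all flip: gen_e, simp_all add: a_def b_def c_def)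
      then obtain i j k where "gen x = e i j k" by blast
      then show "gen x \<in> ?E" "inv\<^bsub>G\<^esub> (gen x) \<in> ?E" using inv_e by auto
    qed
    have "?N #>\<^bsub>free_group\<^esub> w \<in> ?E" if "w \<in> carrier free_group" for w
      using that
    proof (induction w rule: free_group_induct)
      case one
      have "?N #>\<^bsub>free_group\<^esub> \<one>\<^bsub>free_group\<^esub> = e 0 0 0" by (simp add: e_def)
      then show ?case by blast
    next
      case (gen x B)
      then show ?case
        using mult_range[OF gen_range(1)] by (simp add: free_gen_in_carrier gen_eq)
    next
      case (inv_gen x B)
      then show ?case
        using mult_range[OF gen_range(2)] by (simp add: free_gen_in_carrier gen_eq)
    qed
    then show ?thesis
      using that by (auto simp: G_def heis_group_def presented_group_def carrier_FactGroup)
  qed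
  have e_eqI: "e x y z = e x' y' z'"
    if "[x = x'] (mod int p)" "[y = y'] (mod int p)" "[z = z'] (mod int p)" for x y z x' y' z'
  proof -
    have "a [^]\<^bsub>G\<^esub> x = a [^]\<^bsub>G\<^esub> x'" "b [^]\<^bsub>G\<^esub> y = b [^]\<^bsub>G\<^esub> y'" "c [^]\<^bsub>G\<^esub> z = c [^]\<^bsub>G\<^esub> z'"
      using that pow by (simp_all add: H.int_pow_eqI[where n = p] a_def b_def c_def)
    then show ?thesis by (simp add: e_def)
  qed
  have e_eqD: "[x = x'] (mod int p) \<and> [y = y'] (mod int p) \<and> [z = z'] (mod int p)"
    if "e x y z = e x' y' z'" for x y z x' y' z'
  proof -
    obtain \<Phi> where \<Phi>: "\<Phi> \<in> hom G (heis_model p)"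
      and \<Phi>_gen: "\<Phi> a = (1 mod int p, 0, 0)" "\<Phi> b = (0, 1 mod int p, 0)" "\<Phi> c = (0, 0, 1 mod int p)"
      using heis_model_hom_exists[OF p] unfolding G_def a_def b_def c_def gen_def by metis
    interpret \<Phi>: group_hom G "heis_model p" \<Phi>
      using \<Phi> H.group_axioms group_heis_model[OF p]
      by (simp add: group_hom_def group_hom_axioms_def)
    \<comment> \<open>With the factors in the order \<open>b\<close>, \<open>a\<close>,
      \<open>c\<close>, every cocycle term in this product vanishes, and the exponents are read off
      unchanged.\<close>
    have "\<Phi> (e x y z) = (x mod int p, y mod int p, z mod int p)" for x y z
      by (simp add: e_def \<Phi>.hom_int_pow \<Phi>_gen heis_model_int_pow[OF p])
        (simp add: heis_model_def)
    then show ?thesis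
      using that by (simp add: cong_def) (metis prod.inject)
  qed
  have pow_gen: "a [^]\<^bsub>G\<^esub> i = e (int i) 0 0" "b [^]\<^bsub>G\<^esub> i = e 0 (int i) 0" for i :: nat
    by (simp_all add: e_def int_pow_int)
  show thesis
  proof
    show "heis_coordinates (heis_group p) p e"
      unfolding G_def[symmetric]
    proof (intro heis_coordinates.intro heis_coordinates_axioms.intro)
      show "carrier G = {e x y z |x y z. True}"
        using range by auto
      show "e x y z = e x' y' z' \<longleftrightarrow>
          [x = x'] (mod int p) \<and> [y = y'] (mod int p) \<and> [z = z'] (mod int p)" for x y z x' y' z'
        using e_eqI e_eqD by blast
    qed (use assms e_mult H.group_axioms in auto)
    \<comment> \<open>The exponents \<open>1, ..., p - 1\<close> represent exactly the nonzero
      classes. Stated for any periodic \<open>f\<close>, it serves the powers of \<open>a\<close>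
      and of \<open>b\<close> alike.\<close>
    have nonzero: "{f (int i) |i. i \<in> {1..p - 1}} = {f i |i. \<not> [i = 0] (mod int p)}"
      if f: "\<And>i j. [i = j] (mod int p) \<Longrightarrow> f i = f j" for f :: "int \<Rightarrow> 'b"
    proof (intro equalityI subsetI)
      fix g assume "g \<in> {f (int i) |i. i \<in> {1..p - 1}}"
      then obtain i where "g = f (int i)" "0 < i" "i < p" by auto
      moreover have "\<not> [int i = 0] (mod int p)"
        using \<open>0 < i\<close> \<open>i < p\<close> by (simp add: cong_def)
      ultimately show "g \<in> {f i |i. \<not> [i = 0] (mod int p)}" by blast
    next
      fix g assume "g \<in> {f i |i. \<not> [i = 0] (mod int p)}"
      then obtain i where i: "g = f i" "\<not> [i = 0] (mod int p)" by auto
      define k where "k = nat (i mod int p)"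
      have k: "int k = i mod int p" using p by (simp add: k_def)
      have "g = f (int k)" unfolding i k by (rule f) (simp add: cong_def)
      moreover have "k \<in> {1..p - 1}"
        using i(2) p pos_mod_bound[of "int p" i] unfolding cong_def k[symmetric] by auto
      ultimately show "g \<in> {f (int i) |i. i \<in> {1..p - 1}}" by blast
    qed
    have "{e (int i) 0 0 |i. i \<in> {1..p - 1}} = {e i 0 0 |i. \<not> [i = 0] (mod int p)}"
      "{e 0 (int i) 0 |i. i \<in> {1..p - 1}} = {e 0 i 0 |i. \<not> [i = 0] (mod int p)}"
      by (rule nonzero, rule e_eqI; simp)+
    then show "heis_connection_set p =
      {e i 0 0 |i. \<not> [i = 0] (mod int p)} \<union> {e 0 i 0 |i. \<not> [i = 0] (mod int p)}"
      unfolding heis_connection_set_def Let_def G_def[symmetric] gen_def[symmetric]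
        a_def[symmetric] b_def[symmetric] pow_gen
      by simp
  qed
qed

section \<open>Automorphisms and distances of graphs\<close>

lemma graph_auts_in_verts: "f \<in> graph_auts \<Gamma> \<Longrightarrow> u \<in> pverts \<Gamma> \<Longrightarrow> f u \<in> pverts \<Gamma>"
  by (auto simp: graph_auts_def dest: Bij_imp_funcset)

lemma graph_auts_arc_iff:
  "f \<in> graph_auts \<Gamma> \<Longrightarrow> u \<in> pverts \<Gamma> \<Longrightarrow> v \<in> pverts \<Gamma> \<Longrightarrow> (f u, f v) \<in> parcs \<Gamma> \<longleftrightarrow> (u, v) \<in> parcs \<Gamma>"
  by (simp add: graph_auts_def)

lemma graph_auts_compose:
  assumes "f \<in> graph_auts \<Gamma>" "g \<in> graph_auts \<Gamma>"
  shows "compose (pverts \<Gamma>) f g \<in> graph_auts \<Gamma>"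
  using assms graph_auts_in_verts[OF assms(2)]
  by (auto simp: graph_auts_def compose_Bij compose_eq)

lemma graph_auts_inverse:
  assumes f: "f \<in> graph_auts \<Gamma>"
  shows "restrict (inv_into (pverts \<Gamma>) f) (pverts \<Gamma>) \<in> graph_auts \<Gamma>"
proof -
  have Bij: "f \<in> Bij (pverts \<Gamma>)" using f by (simp add: graph_auts_def)
  then have "f (inv_into (pverts \<Gamma>) f u) = u" if "u \<in> pverts \<Gamma>" for u
    using that by (auto simp: Bij_def bij_betw_def f_inv_into_f)
  then have "(inv_into (pverts \<Gamma>) f u, inv_into (pverts \<Gamma>) f v) \<in> parcs \<Gamma> \<longleftrightarrow> (u, v) \<in> parcs \<Gamma>"
    if "u \<in> pverts \<Gamma>" "v \<in> pverts \<Gamma>" for u v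
    using graph_auts_arc_iff[OF f Bij_inv_into_mem[OF Bij that(1)] Bij_inv_into_mem[OF Bij that(2)]]
      that by simp
  then show ?thesis
    using restrict_inv_into_Bij[OF Bij] by (simp add: graph_auts_def)
qed

lemma graph_auts_inverse_obtain:
  assumes f: "f \<in> graph_auts \<Gamma>"
  obtains g where "g \<in> graph_auts \<Gamma>" "\<And>u. u \<in> pverts \<Gamma> \<Longrightarrow> g (f u) = u"
    "\<And>u. u \<in> pverts \<Gamma> \<Longrightarrow> f (g u) = u"
proof (rule that[OF graph_auts_inverse[OF f]])
  have "bij_betw f (pverts \<Gamma>) (pverts \<Gamma>)" using f by (simp add: graph_auts_def Bij_def)
  then show "restrict (inv_into (pverts \<Gamma>) f) (pverts \<Gamma>) (f u) = u"
    "f (restrict (inv_into (pverts \<Gamma>) f) (pverts \<Gamma>) u) = u" if "u \<in> pverts \<Gamma>" for u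
    using that graph_auts_in_verts[OF f that]
    by (auto simp: bij_betw_def f_inv_into_f)
qed

lemma subgroup_graph_auts: "subgroup (graph_auts \<Gamma>) (BijGroup (pverts \<Gamma>))"
proof (rule group.subgroupI[OF group_BijGroup])
  show "graph_auts \<Gamma> \<subseteq> carrier (BijGroup (pverts \<Gamma>))"
    by (auto simp: graph_auts_def BijGroup_def)
  have "(\<lambda>x\<in>pverts \<Gamma>. x) \<in> graph_auts \<Gamma>"
    by (simp add: graph_auts_def id_Bij)
  then show "graph_auts \<Gamma> \<noteq> {}" by blast
  fix f assume f: "f \<in> graph_auts \<Gamma>"
  then have fB: "f \<in> Bij (pverts \<Gamma>)" by (simp add: graph_auts_def)
  show "inv\<^bsub>BijGroup (pverts \<Gamma>)\<^esub> f \<in> graph_auts \<Gamma>"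
    unfolding inv_BijGroup[OF fB] by (rule graph_auts_inverse[OF f])
  fix g assume g: "g \<in> graph_auts \<Gamma>"
  then have "g \<in> Bij (pverts \<Gamma>)" by (simp add: graph_auts_def)
  then show "f \<otimes>\<^bsub>BijGroup (pverts \<Gamma>)\<^esub> g \<in> graph_auts \<Gamma>"
    using graph_auts_compose[OF f g] fB by (simp add: BijGroup_def)
qed

text \<open>The distance is an infimum of walk costs in \<open>ereal\<close>. With unit weights the
  costs are natural numbers, so a finite infimum is attained by a shortest walk; walks of length
  \<open>n\<close> are the pairs of the \<open>n\<close>-th relation power.\<close>

lemma graph_dist_eq_iff:
  assumes wf: "pair_wf_digraph \<Gamma>" and u: "u \<in> pverts \<Gamma>"
  shows "graph_dist \<Gamma> u v = ereal (real n) \<longleftrightarrow>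
    (u, v) \<in> parcs \<Gamma> ^^ n \<and> (\<forall>m<n. (u, v) \<notin> parcs \<Gamma> ^^ m)"
proof -
  interpret pair_wf_digraph \<Gamma> by (rule wf)
  have cost: "awalk_cost (\<lambda>_. 1) p = real (length p)" for p :: "('a \<times> 'a) list"
    by (induction p) simp_all
  have walk: "(\<exists>p. awalk u p v \<and> length p = m) \<longleftrightarrow> (u, v) \<in> parcs \<Gamma> ^^ m" if "u \<in> pverts \<Gamma>" for m u
    using that
  proof (induction m arbitrary: u)
    case 0
    then show ?case by (simp add: awalk_Nil_iff)
  next
    case (Suc m)
    have "(\<exists>p. awalk u p v \<and> length p = Suc m) \<longleftrightarrow> (\<exists>e p. awalk u (e # p) v \<and> length p = m)"
      by (metis length_Suc_conv)
    also have "\<dots> \<longleftrightarrow> (\<exists>w p. (u, w) \<in> parcs \<Gamma> \<and> awalk w p v \<and> length p = m)"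
      unfolding awalk_Cons_iff by (metis fst_conv snd_conv prod.collapse)
    also have "\<dots> \<longleftrightarrow> (\<exists>w. (u, w) \<in> parcs \<Gamma> \<and> (w, v) \<in> parcs \<Gamma> ^^ m)"
      using Suc.IH in_arcsD2 by blast
    also have "\<dots> \<longleftrightarrow> (u, v) \<in> parcs \<Gamma> ^^ Suc m"
      by (metis relpow_Suc_D2 relpow_Suc_I2)
    finally show ?case .
  qed
  have dist: "graph_dist \<Gamma> u v = (INF p\<in>{p. awalk u p v}. ereal (real (length p)))"
    unfolding graph_dist_def \<mu>_def cost ..
  have if_least: "graph_dist \<Gamma> u v = ereal (real n)"
    if "(u, v) \<in> parcs \<Gamma> ^^ n" "\<forall>m<n. (u, v) \<notin> parcs \<Gamma> ^^ m" for n
  proof (rule antisym)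
    show "graph_dist \<Gamma> u v \<le> ereal (real n)"
      using that(1) unfolding walk[OF u, symmetric] dist by (auto intro!: INF_lower2)
    show "ereal (real n) \<le> graph_dist \<Gamma> u v"
      unfolding dist using that(2) walk[OF u]
      by (intro INF_greatest) (metis ereal_less_eq(3) mem_Collect_eq not_less of_nat_le_iff)
  qed
  show ?thesis
  proof
    assume n: "graph_dist \<Gamma> u v = ereal (real n)"
    \<comment> \<open>Over an empty set of walks the infimum would be infinite.\<close>
    then have "{p. awalk u p v} \<noteq> {}"
      unfolding dist by (rule contrapos_pn) (simp add: top_ereal_def)
    then obtain k where "(u, v) \<in> parcs \<Gamma> ^^ k"
      using walk[OF u] by blast
    then have least: "(u, v) \<in> parcs \<Gamma> ^^ (LEAST m. (u, v) \<in> parcs \<Gamma> ^^ m)"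
      "\<forall>k<(LEAST m. (u, v) \<in> parcs \<Gamma> ^^ m). (u, v) \<notin> parcs \<Gamma> ^^ k"
      by (auto intro: LeastI dest: not_less_Least)
    then have "(LEAST m. (u, v) \<in> parcs \<Gamma> ^^ m) = n"
      using if_least[OF least] n by simp
    then show "(u, v) \<in> parcs \<Gamma> ^^ n \<and> (\<forall>m<n. (u, v) \<notin> parcs \<Gamma> ^^ m)"
      using least by simp
  qed (simp add: if_least)
qed

text \<open>Automorphisms carry walks to walks of the same length; the inverse automorphism shows
  that no shorter walk appears.\<close>

lemma graph_dist_aut:
  assumes wf: "pair_wf_digraph \<Gamma>" and f: "f \<in> graph_auts \<Gamma>"
    and u: "u \<in> pverts \<Gamma>" and v: "v \<in> pverts \<Gamma>"
    and dist: "graph_dist \<Gamma> u v = ereal (real n)"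
  shows "graph_dist \<Gamma> (f u) (f v) = ereal (real n)"
proof -
  interpret pair_wf_digraph \<Gamma> by (rule wf)
  have walk: "(h u, h v) \<in> parcs \<Gamma> ^^ m" if "(u, v) \<in> parcs \<Gamma> ^^ m" "h \<in> graph_auts \<Gamma>" for h u v m
    using that(1)
  proof (induction m arbitrary: v)
    case (Suc m)
    then obtain w where "(u, w) \<in> parcs \<Gamma> ^^ m" "(w, v) \<in> parcs \<Gamma>"
      by (auto elim: relpow_Suc_E)
    then show ?case
      using Suc.IH[of w] graph_auts_arc_iff[OF that(2), of w v] wellformed'[of w v]
      by (auto intro: relpow_Suc_I)
  qed simp
  obtain g where g: "g \<in> graph_auts \<Gamma>" "g (f u) = u" "g (f v) = v"
    using graph_auts_inverse_obtain[OF f] u v by metis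
  have "(f u, f v) \<in> parcs \<Gamma> ^^ m \<longleftrightarrow> (u, v) \<in> parcs \<Gamma> ^^ m" for m
    using walk[OF _ f, of u v m] walk[OF _ g(1), of "f u" "f v" m] g(2,3) by auto
  then show ?thesis
    using dist graph_dist_eq_iff[OF wf u] graph_dist_eq_iff[OF wf graph_auts_in_verts[OF f u]]
    by simp
qed

section \<open>Normality and distance transitivity of Cayley graphs\<close>

lemma right_translation_in_auts:
  assumes "group G" and g: "g \<in> carrier G"
  shows "right_translation G g \<in> graph_auts (cayley_graph G S)"
proof -
  interpret group G by (rule assms(1))
  have "bij_betw (right_translation G g) (carrier G) (carrier G)"
    unfolding right_translation_def
    by (rule bij_betw_byWitness[of _ "\<lambda>x. x \<otimes>\<^bsub>G\<^esub> inv\<^bsub>G\<^esub> g"]) (use g in \<open>auto simp: m_assoc\<close>)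
  moreover have "h \<otimes>\<^bsub>G\<^esub> g \<otimes>\<^bsub>G\<^esub> inv\<^bsub>G\<^esub> (k \<otimes>\<^bsub>G\<^esub> g) = h \<otimes>\<^bsub>G\<^esub> inv\<^bsub>G\<^esub> k"
    if "h \<in> carrier G" "k \<in> carrier G" for h k
    using that g by (simp add: inv_mult_group m_assoc mult_inv_cancel_left)
  ultimately show ?thesis
    using g by (auto simp: graph_auts_def cayley_graph_def Bij_def right_translation_def)
qed

lemma auto_in_graph_auts:
  assumes "group G" and f: "f \<in> auto G" and S: "\<And>g. g \<in> carrier G \<Longrightarrow> f g \<in> S \<longleftrightarrow> g \<in> S"
  shows "f \<in> graph_auts (cayley_graph G S)"
proof -
  interpret group_hom G G f
    using assms by (simp add: group_hom_def group_hom_axioms_def auto_def)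
  have "f h \<otimes>\<^bsub>G\<^esub> inv\<^bsub>G\<^esub> f g = f (h \<otimes>\<^bsub>G\<^esub> inv\<^bsub>G\<^esub> g)" if "g \<in> carrier G" "h \<in> carrier G" for g h
    using that by simp
  then show ?thesis
    using f by (auto simp: graph_auts_def cayley_graph_def auto_def S simp del: hom_mult)
qed

text \<open>With \<open>k = f 1\<close>, write \<open>f\<close> as \<open>f0\<close> followed by
  right translation by \<open>k\<close>. Then \<open>f0\<close> fixes the identity, so it is a
  homomorphism by \<open>stab\<close>, and \<open>f (x g) = f x (k^-1 f0(g) k)\<close>: conjugating
  a translation by \<open>f\<close> gives a translation.\<close>

lemma normal_cayley_graphI:
  assumes conn: "connection_set G S"
    and stab: "\<And>f. f \<in> graph_auts (cayley_graph G S) \<Longrightarrow> f \<one>\<^bsub>G\<^esub> = \<one>\<^bsub>G\<^esub> \<Longrightarrow> f \<in> hom G G"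
  shows "normal_cayley_graph G S"
proof -
  interpret group G using conn by (simp add: connection_set_def)
  let ?\<Gamma> = "cayley_graph G S"
  let ?A = "graph_aut_group ?\<Gamma>"
  let ?T = "right_translation G"
  have verts [simp]: "pverts ?\<Gamma> = carrier G" by (simp add: cayley_graph_def)
  have carr: "carrier ?A = graph_auts ?\<Gamma>"
    by (simp add: graph_aut_group_def)
  have A: "group ?A"
    unfolding graph_aut_group_def
    by (rule subgroup.subgroup_is_group[OF subgroup_graph_auts group_BijGroup])
  interpret A: group ?A by (rule A)
  have auts_Bij: "f \<in> Bij (carrier G)" if "f \<in> graph_auts ?\<Gamma>" for f
    using that by (simp add: graph_auts_def)
  have mult: "f \<otimes>\<^bsub>?A\<^esub> g = compose (carrier G) f g" if "f \<in> graph_auts ?\<Gamma>" "g \<in> graph_auts ?\<Gamma>" for f g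
    using that by (simp add: graph_aut_group_def BijGroup_def auts_Bij)
  have one: "\<one>\<^bsub>?A\<^esub> = (\<lambda>x\<in>carrier G. x)"
    by (simp add: graph_aut_group_def BijGroup_def)
  note T_aut = right_translation_in_auts[OF group_axioms, of _ S]
  have T_mult: "?T g \<otimes>\<^bsub>?A\<^esub> ?T h = ?T (h \<otimes>\<^bsub>G\<^esub> g)" if "g \<in> carrier G" "h \<in> carrier G" for g h
    using that
    by (simp add: mult T_aut) (auto simp: fun_eq_iff compose_def right_translation_def m_assoc)
  have T_one: "?T \<one>\<^bsub>G\<^esub> = \<one>\<^bsub>?A\<^esub>"
    by (auto simp: one fun_eq_iff right_translation_def)
  have T_inv: "inv\<^bsub>?A\<^esub> (?T g) = ?T (inv\<^bsub>G\<^esub> g)" if "g \<in> carrier G" for g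
    using that by (intro A.inv_equality) (simp_all add: T_mult T_one carr T_aut)
  have sub: "subgroup (?T ` carrier G) ?A"
    by (rule A.subgroupI) (auto simp: carr T_aut T_mult T_inv)
  have conj: "\<exists>k\<in>carrier G. f \<otimes>\<^bsub>?A\<^esub> ?T g = ?T k \<otimes>\<^bsub>?A\<^esub> f"
    if f: "f \<in> graph_auts ?\<Gamma>" and g: "g \<in> carrier G" for f g
  proof -
    have f_closed: "f x \<in> carrier G" if "x \<in> carrier G" for x
      using graph_auts_in_verts[OF f] that by simp
    define k where "k = f \<one>\<^bsub>G\<^esub>"
    have k: "k \<in> carrier G" by (simp add: k_def f_closed)
    define f0 where "f0 = compose (carrier G) (?T (inv\<^bsub>G\<^esub> k)) f"
    have f0: "f0 \<in> graph_auts ?\<Gamma>"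
      using graph_auts_compose[OF T_aut[of "inv\<^bsub>G\<^esub> k"] f] k by (simp add: f0_def)
    have f0_eq: "f0 x = f x \<otimes>\<^bsub>G\<^esub> inv\<^bsub>G\<^esub> k" if "x \<in> carrier G" for x
      using that by (simp add: f0_def compose_eq right_translation_def f_closed)
    have hom: "f0 \<in> hom G G"
      by (rule stab[OF f0]) (use k in \<open>simp add: f0_eq, simp add: k_def\<close>)
    have f0_closed: "f0 x \<in> carrier G" if "x \<in> carrier G" for x
      using hom that by (rule hom_in_carrier)
    have f_eq: "f x = f0 x \<otimes>\<^bsub>G\<^esub> k" if "x \<in> carrier G" for x
      using that k by (simp add: f0_eq f_closed m_assoc)
    let ?h = "inv\<^bsub>G\<^esub> k \<otimes>\<^bsub>G\<^esub> (f0 g \<otimes>\<^bsub>G\<^esub> k)"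
    have h: "?h \<in> carrier G" using k g f0_closed by simp
    have "f (x \<otimes>\<^bsub>G\<^esub> g) = f x \<otimes>\<^bsub>G\<^esub> ?h" if "x \<in> carrier G" for x
      using that g k by (simp add: f_eq hom_mult[OF hom] m_assoc f0_closed mult_inv_cancel_left)
    then have "f \<otimes>\<^bsub>?A\<^esub> ?T g = ?T ?h \<otimes>\<^bsub>?A\<^esub> f"
      using f g h
      by (simp add: mult T_aut) (auto simp: fun_eq_iff compose_def right_translation_def f_closed)
    then show ?thesis using h by blast
  qed
  have "f \<otimes>\<^bsub>?A\<^esub> ?T g \<otimes>\<^bsub>?A\<^esub> inv\<^bsub>?A\<^esub> f \<in> ?T ` carrier G"
    if fA: "f \<in> carrier ?A" and g: "g \<in> carrier G" for f g
  proof -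
    have f: "f \<in> graph_auts ?\<Gamma>" using fA by (simp only: carr)
    obtain k where k: "k \<in> carrier G" and eq: "f \<otimes>\<^bsub>?A\<^esub> ?T g = ?T k \<otimes>\<^bsub>?A\<^esub> f"
      using conj[OF f g] by (elim bexE)
    have "?T k \<in> carrier ?A" using k by (simp only: carr T_aut)
    then have "f \<otimes>\<^bsub>?A\<^esub> ?T g \<otimes>\<^bsub>?A\<^esub> inv\<^bsub>?A\<^esub> f = ?T k"
      unfolding eq using fA A.m_assoc[of "?T k" f "inv\<^bsub>?A\<^esub> f"] by simp
    then show ?thesis using k by simp
  qed
  then have "?T ` carrier G \<lhd> ?A"
    unfolding A.normal_inv_iff using sub by simp
  then show ?thesis
    using conn by (simp add: normal_cayley_graph_def)
qed

text \<open>Right translations move the first vertex of a pair to the identity, so it suffices to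
  reach each sphere around it from one base element. Asking only that \<open>w\<close> reaches the
  sphere spares computing the distance of \<open>w\<close>.\<close>

lemma cayley_t_distance_transitiveI:
  assumes conn: "connection_set G S"
    and base: "\<And>i. i \<in> {1..t} \<Longrightarrow> \<exists>w\<in>carrier G. \<forall>v\<in>carrier G.
      graph_dist (cayley_graph G S) \<one>\<^bsub>G\<^esub> v = ereal (real i) \<longrightarrow>
      (\<exists>f\<in>graph_auts (cayley_graph G S). f \<one>\<^bsub>G\<^esub> = \<one>\<^bsub>G\<^esub> \<and> f w = v)"
  shows "t_distance_transitive t (cayley_graph G S)"
  unfolding t_distance_transitive_def
proof (intro ballI impI, elim conjE)
  interpret group G using conn by (simp add: connection_set_def)
  let ?\<Gamma> = "cayley_graph G S"
  interpret pair_graph ?\<Gamma> by (rule pair_graph_cayley_graph[OF conn])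
  have verts: "pverts ?\<Gamma> = carrier G" by (simp add: cayley_graph_def)
  fix i u v x y
  assume i: "i \<in> {1..t}"
    and u: "u \<in> pverts ?\<Gamma>" and v: "v \<in> pverts ?\<Gamma>" and x: "x \<in> pverts ?\<Gamma>" and y: "y \<in> pverts ?\<Gamma>"
    and uv: "graph_dist ?\<Gamma> u v = ereal (real i)" and xy: "graph_dist ?\<Gamma> x y = ereal (real i)"
  obtain w where w: "w \<in> carrier G"
    and f: "\<And>v. v \<in> carrier G \<Longrightarrow> graph_dist ?\<Gamma> \<one>\<^bsub>G\<^esub> v = ereal (real i) \<Longrightarrow>
      \<exists>f\<in>graph_auts ?\<Gamma>. f \<one>\<^bsub>G\<^esub> = \<one>\<^bsub>G\<^esub> \<and> f w = v"
    using base[OF i] by blast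
  have pair: "\<exists>f\<in>graph_auts ?\<Gamma>. f \<one>\<^bsub>G\<^esub> = u \<and> f w = v"
    if [simp]: "u \<in> carrier G" "v \<in> carrier G" and "graph_dist ?\<Gamma> u v = ereal (real i)" for u v
  proof -
    have "graph_dist ?\<Gamma> (right_translation G (inv\<^bsub>G\<^esub> u) u) (right_translation G (inv\<^bsub>G\<^esub> u) v) = ereal (real i)"
      using that
      by (intro graph_dist_aut[OF pair_wf_digraph
            right_translation_in_auts[OF group_axioms, of "inv\<^bsub>G\<^esub> u" S]])
        (simp_all add: verts)
    then have "graph_dist ?\<Gamma> \<one>\<^bsub>G\<^esub> (v \<otimes>\<^bsub>G\<^esub> inv\<^bsub>G\<^esub> u) = ereal (real i)"
      by (simp add: right_translation_def)
    then obtain f where f: "f \<in> graph_auts ?\<Gamma>" "f \<one>\<^bsub>G\<^esub> = \<one>\<^bsub>G\<^esub>" "f w = v \<otimes>\<^bsub>G\<^esub> inv\<^bsub>G\<^esub> u"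
      using f[of "v \<otimes>\<^bsub>G\<^esub> inv\<^bsub>G\<^esub> u"] by auto
    show ?thesis
    proof (intro bexI conjI)
      show "compose (carrier G) (right_translation G u) f \<in> graph_auts ?\<Gamma>"
        using graph_auts_compose[OF right_translation_in_auts[OF group_axioms, of u S] f(1)]
        by (simp add: verts)
    qed (use f(2,3) w in \<open>simp_all add: compose_eq right_translation_def m_assoc\<close>)
  qed
  obtain f where f: "f \<in> graph_auts ?\<Gamma>" "f \<one>\<^bsub>G\<^esub> = u" "f w = v"
    using pair[of u v] u v uv by (auto simp: verts)
  obtain h where h: "h \<in> graph_auts ?\<Gamma>" "h \<one>\<^bsub>G\<^esub> = x" "h w = y"
    using pair[of x y] x y xy by (auto simp: verts)
  obtain f' where f': "f' \<in> graph_auts ?\<Gamma>" "f' u = \<one>\<^bsub>G\<^esub>" "f' v = w"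
    using graph_auts_inverse_obtain[OF f(1)] f w by (metis one_closed verts)
  show "\<exists>f\<in>graph_auts ?\<Gamma>. f u = x \<and> f v = y"
    using graph_auts_compose[OF h(1) f'(1)] f' h u v
    by (intro bexI[of _ "compose (pverts ?\<Gamma>) h f'"]) (auto simp: compose_eq)
qed

section \<open>Maps preserving the union of two transverse equivalence relations\<close>

locale transverse_equivs =
  fixes V :: "'a set" and \<alpha> \<beta> :: "'a rel"
  assumes equiv_\<alpha>: "equiv V \<alpha>" and equiv_\<beta>: "equiv V \<beta>" and transverse: "\<alpha> \<inter> \<beta> \<subseteq> Id"

lemma (in transverse_equivs) transverse_equivs_swap: "transverse_equivs V \<beta> \<alpha>"
  using equiv_\<alpha> equiv_\<beta> transverse by unfold_locales auto

text \<open>The target pair is kept separate from the source pair so that preserving the two types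
  and exchanging them are instances of one argument.\<close>

locale transverse_equivs_map =
  dom: transverse_equivs V \<alpha> \<beta> + cod: transverse_equivs V \<gamma> \<delta>
  for V :: "'a set" and \<alpha> \<beta> \<gamma> \<delta> and f :: "'a \<Rightarrow> 'a" +
  assumes bij: "bij_betw f V V"
    and union_iff: "\<And>u v. u \<in> V \<Longrightarrow> v \<in> V \<Longrightarrow> (f u, f v) \<in> \<gamma> \<union> \<delta> \<longleftrightarrow> (u, v) \<in> \<alpha> \<union> \<beta>"
begin

definition preserved_at :: "'a \<Rightarrow> bool" where
  "preserved_at u \<longleftrightarrow>
    (\<forall>v. (u, v) \<in> \<alpha> \<longrightarrow> (f u, f v) \<in> \<gamma>) \<and> (\<forall>v. (u, v) \<in> \<beta> \<longrightarrow> (f u, f v) \<in> \<delta>)"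

text \<open>One genuine edge of known type decides the type of both lines through its endpoint,
  because a triangle cannot have edges of both types.\<close>

lemma preserved_at_if_edge:
  assumes uv: "(u, v) \<in> \<alpha>" "u \<noteq> v" "(f u, f v) \<in> \<gamma>"
  shows "preserved_at u"
proof -
  have sub: "\<alpha> \<subseteq> V \<times> V" "\<beta> \<subseteq> V \<times> V"
    using dom.equiv_\<alpha> dom.equiv_\<beta> by (auto dest: equiv_type)
  have sym: "sym \<alpha>" "sym \<beta>" "sym \<gamma>" "sym \<delta>" and trans: "trans \<alpha>" "trans \<beta>" "trans \<gamma>" "trans \<delta>"
    using dom.equiv_\<alpha> dom.equiv_\<beta> cod.equiv_\<alpha> cod.equiv_\<beta> by (auto elim: equivE)
  have inj: "x = y" if "f x = f y" "x \<in> V" "y \<in> V" for x y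
    using bij that by (auto simp: bij_betw_def inj_on_def)
  have V: "u \<in> V" "v \<in> V" using uv sub by auto
  have fuv: "f u \<noteq> f v" using inj V uv by blast
  have edges: "(f x, f y) \<in> \<gamma> \<or> (f x, f y) \<in> \<delta> \<longleftrightarrow> (x, y) \<in> \<alpha> \<or> (x, y) \<in> \<beta>"
    if "x \<in> V" "y \<in> V" for x y
    using union_iff[OF that] by blast
  \<comment> \<open>The images of \<open>u\<close>, \<open>v\<close>, \<open>w\<close> are pairwise
    joined. If the edge to \<open>f w\<close> changed type, both edges at \<open>f w\<close> would
    be in \<delta>, and so would \<open>(f u, f v)\<close>, against transversality.\<close>
  have \<alpha>_case: "(f u, f w) \<in> \<gamma>" if w: "(u, w) \<in> \<alpha>" for w
  proof (rule ccontr)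
    assume n: "(f u, f w) \<notin> \<gamma>"
    have "w \<in> V" using w sub by auto
    have "(v, w) \<in> \<alpha>" using uv(1) w sym trans by (meson symD transD)
    then have "(f v, f w) \<in> \<gamma> \<or> (f v, f w) \<in> \<delta>" using edges V \<open>w \<in> V\<close> by blast
    moreover have "(f u, f w) \<in> \<delta>" using edges[OF V(1) \<open>w \<in> V\<close>] w n by blast
    moreover have "(f v, f w) \<notin> \<gamma>" using n uv(3) trans(3) by (meson transD)
    ultimately have "(f u, f v) \<in> \<delta>" using sym(4) trans(4) by (meson symD transD)
    then show False using uv(3) fuv cod.transverse by blast
  qed
  \<comment> \<open>If the image edge were in \<gamma>, then \<open>f v\<close> and
    \<open>f w\<close> would be joined, hence also \<open>v\<close> and \<open>w\<close>; either
    type for that edge forces two points of the triangle \<open>u\<close>, \<open>v\<close>,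
    \<open>w\<close> to coincide.\<close>
  have \<beta>_case: "(f u, f w) \<in> \<delta>" if w: "(u, w) \<in> \<beta>" for w
  proof (rule ccontr)
    assume n: "(f u, f w) \<notin> \<delta>"
    have "w \<in> V" using w sub by auto
    have "(f u, f w) \<in> \<gamma>" using edges[OF V(1) \<open>w \<in> V\<close>] w n by blast
    then have "(f v, f w) \<in> \<gamma>" using uv(3) sym(3) trans(3) by (meson symD transD)
    then have "(v, w) \<in> \<alpha> \<or> (v, w) \<in> \<beta>" using edges[OF V(2) \<open>w \<in> V\<close>] by blast
    then have "(u, w) \<in> \<alpha> \<or> (u, v) \<in> \<beta>"
      using uv(1) w sym trans by (meson symD transD)
    then have "u = w" using w uv dom.transverse by blast
    then have "(f u, f w) \<in> \<delta>"
      using cod.equiv_\<beta> bij V by (auto simp: equiv_def refl_on_def bij_betw_def)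
    then show False using n by blast
  qed
  show ?thesis using \<alpha>_case \<beta>_case by (simp add: preserved_at_def)
qed

text \<open>The edge from \<open>v\<close> back to \<open>u\<close> is the witness at
  \<open>v\<close>. For an edge in \<beta> both pairs of relations are exchanged beforehand.\<close>

lemma preserved_at_step:
  assumes "preserved_at u" "(u, v) \<in> \<alpha> \<union> \<beta>"
  shows "preserved_at v"
proof (cases "u = v")
  case False
  interpret swap: transverse_equivs_map V \<beta> \<alpha> \<delta> \<gamma> f
    using dom.transverse_equivs_swap cod.transverse_equivs_swap bij union_iff
    by (auto simp: transverse_equivs_map_def transverse_equivs_map_axioms_def)
  have sym: "sym \<alpha>" "sym \<beta>" "sym \<gamma>" "sym \<delta>"
    using dom.equiv_\<alpha> dom.equiv_\<beta> cod.equiv_\<alpha> cod.equiv_\<beta> by (auto elim: equivE)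
  show ?thesis
    using assms(2)
  proof
    assume "(u, v) \<in> \<alpha>"
    then show ?thesis
      using assms(1) False sym by (intro preserved_at_if_edge[of v u]) (auto simp: preserved_at_def dest: symD)
  next
    assume "(u, v) \<in> \<beta>"
    then have "swap.preserved_at v"
      using assms(1) False sym by (intro swap.preserved_at_if_edge[of v u]) (auto simp: preserved_at_def dest: symD)
    then show ?thesis by (simp add: preserved_at_def swap.preserved_at_def)
  qed
qed (use assms in simp)

lemma preserved:
  assumes edge: "(u, v) \<in> \<alpha>" "u \<noteq> v" "(f u, f v) \<in> \<gamma>"
    and connected: "\<And>w. w \<in> V \<Longrightarrow> (u, w) \<in> (\<alpha> \<union> \<beta>)\<^sup>*"
    and xy: "x \<in> V" "y \<in> V"
  shows "(f x, f y) \<in> \<gamma> \<longleftrightarrow> (x, y) \<in> \<alpha>" and "(f x, f y) \<in> \<delta> \<longleftrightarrow> (x, y) \<in> \<beta>"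
proof -
  have "preserved_at w" if "(u, w) \<in> (\<alpha> \<union> \<beta>)\<^sup>*" for w
    using that by induction (auto intro: preserved_at_if_edge[OF edge] preserved_at_step)
  then have "preserved_at x" using connected xy(1) by blast
  then have imp: "(x, y) \<in> \<alpha> \<Longrightarrow> (f x, f y) \<in> \<gamma>" "(x, y) \<in> \<beta> \<Longrightarrow> (f x, f y) \<in> \<delta>"
    by (auto simp: preserved_at_def)
  have inj: "f x = f y \<Longrightarrow> x = y"
    using bij xy by (auto simp: bij_betw_def inj_on_def)
  have refl: "(x, x) \<in> \<alpha>" "(x, x) \<in> \<beta>"
    using dom.equiv_\<alpha> dom.equiv_\<beta> xy by (auto simp: equiv_def refl_on_def)
  show "(f x, f y) \<in> \<gamma> \<longleftrightarrow> (x, y) \<in> \<alpha>" "(f x, f y) \<in> \<delta> \<longleftrightarrow> (x, y) \<in> \<beta>"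
    \<comment> \<open>For the converse, a pair whose image is in \<gamma> is in \<alpha> or \<beta>;
      in the latter case its image is in both \<gamma> and \<delta>, so the two points agree and
      reflexivity applies.\<close>
    using union_iff[OF xy] imp inj refl cod.transverse by blast+
qed

end

section \<open>The Cayley graph in coordinates\<close>

context heis_coordinates
begin

abbreviation eq_mod (infix \<open>\<approx>\<close> 50) where "x \<approx> y \<equiv> [x = y] (mod int p)"

section \<open>Coordinates and arithmetic modulo \<open>p\<close>\<close>

definition S where "S = {e i 0 0 |i. \<not> i \<approx> 0} \<union> {e 0 i 0 |i. \<not> i \<approx> 0}"

text \<open>An arbitrary integer representative of the exponents; only its classes modulo
  \<open>p\<close> are determined by \<open>g\<close>.\<close>

definition coord where "coord g = (SOME v. g = e (fst v) (fst (snd v)) (snd (snd v)))"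
definition X where "X g = fst (coord g)"
definition Y where "Y g = fst (snd (coord g))"
definition Z where "Z g = snd (snd (coord g))"

text \<open>The cosets of the subgroups generated by \<open>a\<close> and by \<open>b\<close>.\<close>

definition al where "al = {(g, h). g \<in> carrier G \<and> h \<in> carrier G \<and>
  Y g \<approx> Y h \<and> Z g - X g * Y g \<approx> Z h - X h * Y h}"
definition bl where "bl = {(g, h). g \<in> carrier G \<and> h \<in> carrier G \<and> X g \<approx> X h \<and> Z g \<approx> Z h}"

lemma e_closed [simp]: "e x y z \<in> carrier G"
  using carrier_eq by blast

lemma e_coords: "g \<in> carrier G \<Longrightarrow> e (X g) (Y g) (Z g) = g"
proof -
  assume "g \<in> carrier G"
  then have "\<exists>v. g = e (fst v) (fst (snd v)) (snd (snd v))" using carrier_eq by auto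
  from someI_ex[OF this] show ?thesis
    unfolding X_def Y_def Z_def coord_def by (rule sym)
qed

lemma coords_e: "X (e x y z) \<approx> x" "Y (e x y z) \<approx> y" "Z (e x y z) \<approx> z"
  using e_coords[of "e x y z"] e_eq_iff by simp_all

lemma one_eq: "\<one> = e 0 0 0"
proof -
  have "e 0 0 0 \<otimes> e 0 0 0 = e 0 0 0" by (simp add: e_mult)
  then show ?thesis by (metis e_closed r_cancel_one')
qed

lemma inv_e: "inv (e x y z) = e (- x) (- y) (x * y - z)"
  by (rule inv_equality) (simp_all add: e_mult one_eq)

lemma one_not_cong_0: "\<not> 1 \<approx> 0"
  using prime_p prime_gt_1_nat[OF prime_p] by (simp add: cong_def)

lemma prime_int_p: "prime (int p)"
  using prime_p by simp

lemma cong_mult_cancel: "\<not> k \<approx> 0 \<Longrightarrow> k * x \<approx> k * y \<longleftrightarrow> x \<approx> y"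
  using prime_int_p by (metis cong_0_iff cong_mult_lcancel coprime_commute prime_imp_coprime)

lemma cong_mult_0_iff: "x * y \<approx> 0 \<longleftrightarrow> x \<approx> 0 \<or> y \<approx> 0"
  using prime_int_p by (simp add: cong_0_iff prime_dvd_mult_iff)

lemma cong_solve: "\<not> k \<approx> 0 \<Longrightarrow> \<exists>t. k * t \<approx> m"
proof -
  assume "\<not> k \<approx> 0"
  then have "coprime k (int p)"
    using prime_int_p by (metis cong_0_iff coprime_commute prime_imp_coprime)
  then obtain t where "k * t \<approx> 1" using cong_solve_coprime_int by blast
  then have "k * (t * m) \<approx> m"
    using cong_scalar_right[of "k * t" 1 "int p" m] by (simp add: mult.assoc)
  then show ?thesis by blast
qed

section \<open>Lines, adjacency and transversals\<close>

lemma equiv_al: "equiv (carrier G) al"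
  by (rule equivI) (auto simp: al_def refl_on_def sym_def trans_def intro: cong_sym cong_trans)

lemma equiv_bl: "equiv (carrier G) bl"
  by (rule equivI) (auto simp: bl_def refl_on_def sym_def trans_def intro: cong_sym cong_trans)

lemma al_e_iff: "(e x y z, e x' y' z') \<in> al \<longleftrightarrow> y \<approx> y' \<and> z - x * y \<approx> z' - x' * y'"
proof -
  have Y: "Y (e x y z) mod int p = y mod int p" for x y z
    using coords_e(2) by (simp add: cong_def)
  have "(Z (e x y z) - X (e x y z) * Y (e x y z)) mod int p = (z - x * y) mod int p" for x y z
    using coords_e by (intro cong_diff[unfolded cong_def] cong_mult[unfolded cong_def])
      (auto simp: cong_def)
  then show ?thesis using Y by (simp add: al_def cong_def)
qed

lemma bl_e_iff: "(e x y z, e x' y' z') \<in> bl \<longleftrightarrow> x \<approx> x' \<and> z \<approx> z'"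
  using coords_e(1,3) by (simp add: bl_def cong_def)

lemma carrier_cases:
  assumes "g \<in> carrier G" obtains x y z where "g = e x y z"
  using assms carrier_eq by blast

lemma S_iff: "e x y z \<in> S \<longleftrightarrow> z \<approx> 0 \<and> (\<not> x \<approx> 0 \<and> y \<approx> 0 \<or> x \<approx> 0 \<and> \<not> y \<approx> 0)"
proof -
  have "e x y z \<in> S \<longleftrightarrow> (\<exists>i. \<not> i \<approx> 0 \<and> x \<approx> i \<and> y \<approx> 0 \<and> z \<approx> 0) \<or>
      (\<exists>i. \<not> i \<approx> 0 \<and> x \<approx> 0 \<and> y \<approx> i \<and> z \<approx> 0)"
    by (auto simp: S_def e_eq_iff)
  also have "\<dots> \<longleftrightarrow> z \<approx> 0 \<and> (\<not> x \<approx> 0 \<and> y \<approx> 0 \<or> x \<approx> 0 \<and> \<not> y \<approx> 0)"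
    by (metis cong_refl cong_sym cong_trans)
  finally show ?thesis .
qed

abbreviation \<Gamma> where "\<Gamma> \<equiv> cayley_graph G S"

lemma verts [simp]: "pverts \<Gamma> = carrier G"
  by (simp add: cayley_graph_def)

lemma transverse: "al \<inter> bl \<subseteq> Id"
proof clarify
  fix g h assume "(g, h) \<in> al" "(g, h) \<in> bl"
  then have "e (X g) (Y g) (Z g) = e (X h) (Y h) (Z h)" "g \<in> carrier G" "h \<in> carrier G"
    by (auto simp: al_def bl_def e_eq_iff)
  then show "g = h" by (simp add: e_coords)
qed

text \<open>The last coordinate of \<open>h g^-1\<close> is \<open>z' - z + x y - x' y\<close>. When
  the \<open>x\<close> agree it is the change of \<open>z\<close>, and when the \<open>y\<close>
  agree it is the change of \<open>z - x y\<close>; these are the invariants of the two kinds of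
  line.\<close>

lemma arc_iff:
  assumes "g \<in> carrier G" "h \<in> carrier G"
  shows "(g, h) \<in> parcs \<Gamma> \<longleftrightarrow> (g, h) \<in> al \<union> bl \<and> g \<noteq> h"
proof -
  obtain x y z x' y' z' where [simp]: "g = e x y z" "h = e x' y' z'"
    using assms carrier_cases by metis
  have sub0: "u - v \<approx> 0 \<longleftrightarrow> v \<approx> u" for u v
    by (metis cong_diff_iff_cong_0 cong_sym_eq)
  have "(g, h) \<in> parcs \<Gamma> \<longleftrightarrow> e (x' - x) (y' - y) (z' - z + x * y - x' * y) \<in> S"
    by (simp add: cayley_graph_def inv_e e_mult algebra_simps)
  also have "\<dots> \<longleftrightarrow> (z' - z + x * y - x' * y) \<approx> 0 \<and> (\<not> x \<approx> x' \<and> y \<approx> y' \<or> x \<approx> x' \<and> \<not> y \<approx> y')"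
    by (simp add: S_iff sub0)
  also have "\<dots> \<longleftrightarrow> (g, h) \<in> al \<union> bl \<and> g \<noteq> h"
  proof -
    have "(z' - z + x * y - x' * y) \<approx> 0 \<longleftrightarrow> z \<approx> z'" if "x \<approx> x'"
    proof -
      have "(x - x') * y \<approx> 0" using that cong_mult_0_iff[of "x - x'" y] sub0[of x x'] cong_sym by blast
      then have "z' - z + (x - x') * y \<approx> z' - z + 0" by (intro cong_add) auto
      then have "z' - z + x * y - x' * y \<approx> z' - z" by (simp add: algebra_simps)
      then show ?thesis using sub0 by (metis cong_sym cong_trans)
    qed
    moreover have "(z' - z + x * y - x' * y) \<approx> 0 \<longleftrightarrow> z - x * y \<approx> z' - x' * y'" if "y \<approx> y'"
    proof -
      have "z' - x' * y' \<approx> z' - x' * y"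
        using that by (intro cong_diff cong_mult) (auto simp: cong_sym_eq)
      then have "z - x * y \<approx> z' - x' * y' \<longleftrightarrow> z - x * y \<approx> z' - x' * y"
        by (metis cong_sym cong_trans)
      also have "\<dots> \<longleftrightarrow> (z' - x' * y) - (z - x * y) \<approx> 0" by (simp add: sub0)
      finally show ?thesis by (simp add: algebra_simps)
    qed
    ultimately show ?thesis
      by (auto simp: al_e_iff bl_e_iff e_eq_iff)
  qed
  finally show ?thesis .
qed

text \<open>A line in direction \<open>b\<close> is given by its \<open>x\<close> and
  \<open>z\<close>. An \<open>a\<close>-line at height \<open>t\<close> meets two of them iff
  \<open>(x - x') t = z - z'\<close> modulo \<open>p\<close>, which is always solvable when
  \<open>x\<close> and \<open>x'\<close> differ; otherwise the lines must coincide.\<close>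

lemma bl_al_bl_iff: "(e x y z, e x' y' z') \<in> bl O al O bl \<longleftrightarrow> z \<approx> z' \<or> \<not> x \<approx> x'"
proof
  assume "(e x y z, e x' y' z') \<in> bl O al O bl"
  then obtain g h where gh: "(e x y z, g) \<in> bl" "(g, h) \<in> al" "(h, e x' y' z') \<in> bl" by blast
  then have "g \<in> carrier G" "h \<in> carrier G" by (auto simp: al_def)
  then obtain u v w u' v' w' where eq: "g = e u v w" "h = e u' v' w'"
    using carrier_cases by metis
  show "z \<approx> z' \<or> \<not> x \<approx> x'"
  proof (rule disjCI, drule notnotD)
    assume "x \<approx> x'"
    then have "u * v \<approx> u' * v'" "w - u * v \<approx> w' - u' * v'" "z \<approx> w" "w' \<approx> z'"
      using gh cong_trans cong_sym unfolding eq al_e_iff bl_e_iff by (meson cong_mult)+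
    from cong_add[OF this(2,1)] this(3,4) show "z \<approx> z'"
      by simp (meson cong_trans)
  qed
next
  assume *: "z \<approx> z' \<or> \<not> x \<approx> x'"
  show "(e x y z, e x' y' z') \<in> bl O al O bl"
  proof -
    have "\<exists>t. (x - x') * t \<approx> z - z'"
    proof (cases "x \<approx> x'")
      case True
      then have "z - z' \<approx> 0" using * by (simp add: cong_diff_iff_cong_0)
      then show ?thesis by (intro exI[of _ 0]) (simp add: cong_sym_eq)
    next
      case False
      then show ?thesis by (intro cong_solve) (simp add: cong_diff_iff_cong_0)
    qed
    then obtain t where t: "(x - x') * t \<approx> z - z'" by blast
    have "z - x * t \<approx> z' - x' * t"
      using cong_diff[OF cong_refl t, of "z - x' * t"] by (simp add: algebra_simps cong_sym_eq)
    then show ?thesis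
      by (intro relcompI[of _ "e x t z"] relcompI[of _ "e x' t z'"]) (simp_all add: al_e_iff bl_e_iff)
  qed
qed

text \<open>Dual to the previous count: with \<open>m = z - x y\<close>, the \<open>b\<close>-line
  at first coordinate \<open>t\<close> meets both \<open>a\<close>-lines iff
  \<open>(y - y') t = m' - m\<close> modulo \<open>p\<close>.\<close>

lemma al_bl_al_iff:
  "(e x y z, e x' y' z') \<in> al O bl O al \<longleftrightarrow> z - x * y \<approx> z' - x' * y' \<or> \<not> y \<approx> y'"
proof
  assume "(e x y z, e x' y' z') \<in> al O bl O al"
  then obtain g h where gh: "(e x y z, g) \<in> al" "(g, h) \<in> bl" "(h, e x' y' z') \<in> al" by blast
  then have "g \<in> carrier G" "h \<in> carrier G" by (auto simp: bl_def)
  then obtain u v w u' v' w' where eq: "g = e u v w" "h = e u' v' w'"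
    using carrier_cases by metis
  show "z - x * y \<approx> z' - x' * y' \<or> \<not> y \<approx> y'"
  proof (rule disjCI, drule notnotD)
    assume "y \<approx> y'"
    then have "u * v \<approx> u' * v'" "w \<approx> w'" "z - x * y \<approx> w - u * v" "w' - u' * v' \<approx> z' - x' * y'"
      using gh cong_trans cong_sym unfolding eq al_e_iff bl_e_iff by (meson cong_mult)+
    from cong_diff[OF this(2,1)] this(3,4) show "z - x * y \<approx> z' - x' * y'"
      by (meson cong_trans)
  qed
next
  let ?m = "z - x * y" and ?m' = "z' - x' * y'"
  assume *: "?m \<approx> ?m' \<or> \<not> y \<approx> y'"
  have "\<exists>t. (y - y') * t \<approx> ?m' - ?m"
  proof (cases "y \<approx> y'")
    case True
    then have "?m' \<approx> ?m" using * cong_sym by blast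
    then have "?m' - ?m \<approx> 0" by (simp only: cong_diff_iff_cong_0)
    then show ?thesis by (intro exI[of _ 0]) (simp add: cong_sym_eq)
  next
    case False
    then show ?thesis by (intro cong_solve) (simp add: cong_diff_iff_cong_0)
  qed
  then obtain t where t: "(y - y') * t \<approx> ?m' - ?m" by blast
  have "?m + t * y \<approx> ?m' + t * y'"
    using cong_add[OF cong_refl t, of "?m + t * y'"] by (simp add: algebra_simps)
  then show "(e x y z, e x' y' z') \<in> al O bl O al"
    by (intro relcompI[of _ "e t y (?m + t * y)"] relcompI[of _ "e t y' (?m' + t * y')"])
      (simp_all add: al_e_iff bl_e_iff)
qed

text \<open>
  Lines of one type are parallel iff no line of the other type meets both; this makes
  \<open>X\<close> and \<open>Y\<close> transform separately. Comparing the two remaining incidence conditions then gives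
  \<open>H (w + x y) = H w + A x \<cdot> B y\<close>, which forces additivity.
\<close>

lemma line_preserving_form:
  assumes f: "bij_betw f (carrier G) (carrier G)" and f_one: "f \<one> = \<one>"
    and al: "\<And>g h. g \<in> carrier G \<Longrightarrow> h \<in> carrier G \<Longrightarrow> (f g, f h) \<in> al \<longleftrightarrow> (g, h) \<in> al"
    and bl: "\<And>g h. g \<in> carrier G \<Longrightarrow> h \<in> carrier G \<Longrightarrow> (f g, f h) \<in> bl \<longleftrightarrow> (g, h) \<in> bl"
  obtains A B H where "\<And>x y z. f (e x y z) = e (A x) (B y) (H z)"
    "\<And>x x'. A (x + x') \<approx> A x + A x'" "\<And>y y'. B (y + y') \<approx> B y + B y'"
    "\<And>z x y. H (z + x * y) \<approx> H z + A x * B y" "\<And>z z'. H (z + z') \<approx> H z + H z'"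
proof -
  have f_closed: "f g \<in> carrier G" if "g \<in> carrier G" for g
    using f that by (auto simp: bij_betw_def)
  \<comment> \<open>Surjectivity of \<open>f\<close> lets intermediate points be pulled
    back.\<close>
  have relcomp: "(f g, f h) \<in> r O s \<longleftrightarrow> (g, h) \<in> r O s"
    if r: "\<And>g h. g \<in> carrier G \<Longrightarrow> h \<in> carrier G \<Longrightarrow> (f g, f h) \<in> r \<longleftrightarrow> (g, h) \<in> r"
      and s: "\<And>g h. g \<in> carrier G \<Longrightarrow> h \<in> carrier G \<Longrightarrow> (f g, f h) \<in> s \<longleftrightarrow> (g, h) \<in> s"
      and sub: "r \<subseteq> carrier G \<times> carrier G" and gh: "g \<in> carrier G" "h \<in> carrier G" for r s g h
  proof -
    have surj: "\<exists>v\<in>carrier G. u = f v" if "u \<in> carrier G" for u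
      using f that by (auto simp: bij_betw_def)
    have "(f g, f h) \<in> r O s \<longleftrightarrow> (\<exists>u\<in>carrier G. (f g, u) \<in> r \<and> (u, f h) \<in> s)"
      using sub by blast
    also have "\<dots> \<longleftrightarrow> (\<exists>v\<in>carrier G. (f g, f v) \<in> r \<and> (f v, f h) \<in> s)"
      using surj f_closed by blast
    also have "\<dots> \<longleftrightarrow> (\<exists>v\<in>carrier G. (g, v) \<in> r \<and> (v, h) \<in> s)"
      using r s gh by blast
    also have "\<dots> \<longleftrightarrow> (g, h) \<in> r O s"
      using sub by blast
    finally show ?thesis .
  qed
  have sub: "al \<subseteq> carrier G \<times> carrier G" "bl \<subseteq> carrier G \<times> carrier G"
    by (auto simp: al_def bl_def)
  have bab: "(f g, f h) \<in> bl O al O bl \<longleftrightarrow> (g, h) \<in> bl O al O bl"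
    and aba: "(f g, f h) \<in> al O bl O al \<longleftrightarrow> (g, h) \<in> al O bl O al"
    if "g \<in> carrier G" "h \<in> carrier G" for g h
    using that by (intro relcomp[OF bl relcomp[OF al bl sub(1)] sub(2)]
        relcomp[OF al relcomp[OF bl al sub(2)] sub(1)]; simp)+
  define F1 F2 F3 where "F1 x y z = X (f (e x y z))" and "F2 x y z = Y (f (e x y z))"
    and "F3 x y z = Z (f (e x y z))" for x y z
  have f_eq: "f (e x y z) = e (F1 x y z) (F2 x y z) (F3 x y z)" for x y z
    by (simp add: F1_def F2_def F3_def e_coords f_closed)
  define A B H where "A x = F1 x 0 0" and "B y = F2 0 y 0" and "H z = F3 0 0 z" for x y z
  have F1: "F1 x y z \<approx> A x" for x y z
  proof -
    \<comment> \<open>Same \<open>b\<close>-line, or two \<open>b\<close>-lines without transversal: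
      together this expresses exactly that the \<open>x\<close> agree, in terms preserved by
      \<open>f\<close>.\<close>
    have "(e x y z, e x 0 0) \<in> bl \<or> (e x y z, e x 0 0) \<notin> bl O al O bl"
      by (simp add: bl_al_bl_iff bl_e_iff)
    then have "(f (e x y z), f (e x 0 0)) \<in> bl \<or> (f (e x y z), f (e x 0 0)) \<notin> bl O al O bl"
      by (simp only: bl bab e_closed)
    then show ?thesis
      by (auto simp: f_eq bl_al_bl_iff bl_e_iff A_def)
  qed
  have F2: "F2 x y z \<approx> B y" for x y z
  proof -
    have "(e x y z, e 0 y 0) \<in> al \<or> (e x y z, e 0 y 0) \<notin> al O bl O al"
      by (simp add: al_bl_al_iff al_e_iff)
    then have "(f (e x y z), f (e 0 y 0)) \<in> al \<or> (f (e x y z), f (e 0 y 0)) \<notin> al O bl O al"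
      by (simp only: al aba e_closed)
    then show ?thesis
      by (auto simp: f_eq al_bl_al_iff al_e_iff B_def)
  qed
  have zero: "A 0 \<approx> 0" "B 0 \<approx> 0" "H 0 \<approx> 0"
    using f_one unfolding one_eq f_eq e_eq_iff by (simp_all add: A_def B_def H_def)
  have F3_b: "F3 x y z \<approx> F3 x 0 z" for x y z
    using bl[of "e x y z" "e x 0 z"] by (simp add: f_eq bl_e_iff)
  \<comment> \<open>Slide along the \<open>a\<close>-line to \<open>x = 0\<close>, where
    \<open>z - x y\<close> is the third coordinate.\<close>
  have F3_a: "F3 x y z - F1 x y z * F2 x y z \<approx> F3 0 y (z - x * y) - F1 0 y (z - x * y) * F2 0 y (z - x * y)"
    for x y z
    using al[of "e x y z" "e 0 y (z - x * y)"] by (simp add: f_eq al_e_iff)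
  have F3_H: "F3 x y z \<approx> H (z - x * y) + A x * B y" for x y z
  proof -
    have "F1 0 y (z - x * y) \<approx> 0" using F1 zero(1) cong_trans by blast
    then have "F1 0 y (z - x * y) * F2 0 y (z - x * y) \<approx> 0" by (simp add: cong_mult_0_iff)
    moreover have "F3 0 y (z - x * y) \<approx> H (z - x * y)" using F3_b by (simp add: H_def)
    ultimately have "F3 0 y (z - x * y) - F1 0 y (z - x * y) * F2 0 y (z - x * y) \<approx> H (z - x * y) - 0"
      by (intro cong_diff)
    then have "F3 x y z - F1 x y z * F2 x y z \<approx> H (z - x * y)"
      using F3_a cong_trans by (metis diff_zero)
    from cong_add[OF this cong_mult[OF F1 F2, of x y z x y z]] show ?thesis by simp
  qed
  have F3: "F3 x y z \<approx> H z" for x y z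
  proof -
    have "A x * B 0 \<approx> 0" using zero(2) by (simp add: cong_mult_0_iff)
    then have "H z + A x * B 0 \<approx> H z + 0" by (intro cong_add cong_refl)
    then show ?thesis
      using F3_b[of x y z] F3_H[of x 0 z] by simp (meson cong_trans)
  qed
  have H_mult: "H (z + x * y) \<approx> H z + A x * B y" for x y z
    using F3[of x y "z + x * y"] F3_H[of x y "z + x * y"] cong_sym cong_trans by fastforce
  have H_prod: "H (x * y) \<approx> A x * B y" for x y
    using H_mult[of 0 x y] cong_add[OF zero(3) cong_refl, of "A x * B y"]
    by simp (meson cong_trans)
  \<comment> \<open>The case \<open>y = 1\<close>: both \<open>H z'\<close> and the increment equal
    \<open>A z' * B 1\<close>.\<close>
  have H_add: "H (z + z') \<approx> H z + H z'" for z z'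
    using H_mult[of z z' 1] cong_add[OF cong_refl H_prod[of z' 1], of "H z"]
    by simp (meson cong_sym cong_trans)
  have f_form: "f (e x y z) = e (A x) (B y) (H z)" for x y z
    using F1 F2 F3 by (simp add: f_eq e_eq_iff)
  \<comment> \<open>Injectivity on the powers of \<open>c\<close> gives \<open>H 1\<close> nonzero,
    and \<open>H 1\<close> is \<open>A 1 * B 1\<close>.\<close>
  have nonzero: "\<not> A 1 \<approx> 0" "\<not> B 1 \<approx> 0"
  proof -
    have "\<not> H 1 \<approx> 0"
    proof
      assume "H 1 \<approx> 0"
      then have "f (e 0 0 1) = f (e 0 0 0)"
        using zero(3) by (simp add: f_form e_eq_iff) (meson cong_sym cong_trans)
      then have "e 0 0 1 = e 0 0 0"
        using f by (auto simp: bij_betw_def inj_on_def)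
      then show False using one_not_cong_0 by (simp add: e_eq_iff)
    qed
    then have "\<not> A 1 * B 1 \<approx> 0"
      using H_prod[of 1 1] by simp (meson cong_trans)
    then show "\<not> A 1 \<approx> 0" "\<not> B 1 \<approx> 0"
      by (auto simp: cong_mult_0_iff)
  qed
  \<comment> \<open>Up to the invertible factor \<open>B 1\<close>, the map \<open>A\<close> is
    \<open>H\<close>, so it inherits additivity.\<close>
  have A_add: "A (x + x') \<approx> A x + A x'" for x x'
  proof -
    have "A (x + x') * B 1 \<approx> H (x + x')" using H_prod[of "x + x'" 1] by (simp add: cong_sym_eq)
    also have "H (x + x') \<approx> H x + H x'" by (rule H_add)
    also have "H x + H x' \<approx> A x * B 1 + A x' * B 1"
      using H_prod[of x 1] H_prod[of x' 1] by (simp add: cong_add)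
    finally have "B 1 * A (x + x') \<approx> B 1 * (A x + A x')" by (simp add: algebra_simps)
    then show ?thesis using nonzero by (simp add: cong_mult_cancel)
  qed
  have B_add: "B (y + y') \<approx> B y + B y'" for y y'
  proof -
    have "A 1 * B (y + y') \<approx> H (y + y')" using H_prod[of 1 "y + y'"] by (simp add: cong_sym_eq)
    also have "H (y + y') \<approx> H y + H y'" by (rule H_add)
    also have "H y + H y' \<approx> A 1 * B y + A 1 * B y'"
      using H_prod[of 1 y] H_prod[of 1 y'] by (simp add: cong_add)
    finally have "A 1 * B (y + y') \<approx> A 1 * (B y + B y')" by (simp add: algebra_simps)
    then show ?thesis using nonzero by (simp add: cong_mult_cancel)
  qed
  show thesis
    by (rule that[OF f_form A_add B_add H_mult H_add])
qed

section \<open>Finiteness, connectedness and explicit automorphisms\<close>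

lemma finite_carrier: "finite (carrier G)"
proof -
  have p: "0 < int p" using prime_gt_0_nat[OF prime_p] by simp
  have "carrier G \<subseteq> (\<lambda>(x, y, z). e x y z) ` ({0..<int p} \<times> {0..<int p} \<times> {0..<int p})"
  proof
    fix g assume "g \<in> carrier G"
    then obtain x y z where "g = e x y z" by (rule carrier_cases)
    also have "\<dots> = e (x mod int p) (y mod int p) (z mod int p)"
      by (simp add: e_eq_iff cong_def)
    finally show "g \<in> (\<lambda>(x, y, z). e x y z) ` ({0..<int p} \<times> {0..<int p} \<times> {0..<int p})"
      using p by (intro image_eqI[of _ _ "(x mod int p, y mod int p, z mod int p)"]) auto
  qed
  then show ?thesis by (rule finite_subset) simp
qed

lemma connection_set_S: "connection_set G S"
proof -
  have "S \<subseteq> carrier G - {\<one>}"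
    by (auto simp: S_def one_eq e_eq_iff)
  moreover have "inv g \<in> S" if "g \<in> S" for g
    using that by (auto simp: S_def inv_e cong_minus_minus_iff[of _ 0, simplified])
  moreover have "inv (inv g) = g" if "g \<in> S" for g
    using that by (auto simp: S_def)
  ultimately have "(\<lambda>g. inv g) ` S = S"
    by (metis (no_types, lifting) image_eqI image_subsetI subsetI subset_antisym)
  then show ?thesis
    using \<open>S \<subseteq> carrier G - {\<one>}\<close> finite_carrier group_axioms by (simp add: connection_set_def)
qed

lemma pair_graph: "pair_graph \<Gamma>"
  by (rule pair_graph_cayley_graph[OF connection_set_S])

lemma connected: "g \<in> carrier G \<Longrightarrow> (\<one>, g) \<in> (al \<union> bl)\<^sup>*"
proof (elim carrier_cases)
  fix x y z assume g: "g = e x y z"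
  \<comment> \<open>At height \<open>z\<close> an \<open>a\<close>-line keeps
    \<open>z - x y\<close>, so moving \<open>x\<close> from 0 to 1 creates third coordinate
    \<open>z\<close>; the remaining steps adjust \<open>x\<close> and \<open>y\<close>.\<close>
  have "(e 0 0 0, e 0 z 0) \<in> al \<union> bl" "(e 0 z 0, e 1 z z) \<in> al \<union> bl"
    "(e 1 z z, e 1 0 z) \<in> al \<union> bl" "(e 1 0 z, e x 0 z) \<in> al \<union> bl" "(e x 0 z, e x y z) \<in> al \<union> bl"
    by (simp_all add: al_e_iff bl_e_iff)
  then show ?thesis
    unfolding g one_eq by (meson rtrancl.rtrancl_into_rtrancl rtrancl.rtrancl_refl)
qed

text \<open>A formula on integer triples defines a map on the group if it respects congruence and an
  injective one if it reflects it; finiteness supplies surjectivity.\<close>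

lemma coordinate_auto_in_graph_auts:
  assumes resp: "\<And>x y z x' y' z'. e x y z = e x' y' z' \<longleftrightarrow> T x y z = T x' y' z'"
    and closed: "\<And>x y z. T x y z \<in> carrier G"
    and hom: "\<And>x y z x' y' z'. T x y z \<otimes> T x' y' z' = T (x + x') (y + y') (z + z' + x * y')"
    and S_T: "\<And>x y z. T x y z \<in> S \<longleftrightarrow> e x y z \<in> S"
  obtains f where "f \<in> graph_auts \<Gamma>" "\<And>x y z. f (e x y z) = T x y z"
proof -
  define f where "f = (\<lambda>g\<in>carrier G. T (X g) (Y g) (Z g))"
  have f_e: "f (e x y z) = T x y z" for x y z
    using resp[of "X (e x y z)" "Y (e x y z)" "Z (e x y z)" x y z] by (simp add: f_def e_coords)
  have "inj_on f (carrier G)"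
    by (rule inj_onI) (metis carrier_cases f_e resp)
  moreover have f_closed: "f g \<in> carrier G" if "g \<in> carrier G" for g
    using that by (simp add: f_def closed)
  ultimately have "f ` carrier G = carrier G"
    by (intro endo_inj_surj finite_carrier) auto
  then have "f \<in> Bij (carrier G)"
    using \<open>inj_on f (carrier G)\<close> by (auto simp: Bij_def bij_betw_def f_def)
  moreover have "f \<in> hom G G"
  proof (rule homI)
    fix g h assume "g \<in> carrier G" "h \<in> carrier G"
    then obtain x y z x' y' z' where "g = e x y z" "h = e x' y' z'" using carrier_cases by metis
    then show "f (g \<otimes> h) = f g \<otimes> f h" by (simp add: e_mult f_e hom)
  qed (rule f_closed)
  moreover have "f g \<in> S \<longleftrightarrow> g \<in> S" if "g \<in> carrier G" for g
    using that by (rule carrier_cases) (simp add: f_e S_T)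
  ultimately have "f \<in> graph_auts \<Gamma>"
    by (intro auto_in_graph_auts group_axioms) (simp_all add: auto_def)
  then show thesis using f_e that by blast
qed

text \<open>Exchanging \<open>a\<close> and \<open>b\<close> inverts their commutator
  \<open>c\<close>, and \<open>a^y b^x c^-z\<close> collects to
  \<open>b^x a^y c^(x y - z)\<close>.\<close>

lemma swap_aut:
  obtains f where "f \<in> graph_auts \<Gamma>" "\<And>x y z. f (e x y z) = e y x (x * y - z)"
proof (rule coordinate_auto_in_graph_auts[of "\<lambda>x y z. e y x (x * y - z)"])
  fix x y z x' y' z'
  have *: "x * y - z \<approx> x' * y' - z'" if "x \<approx> x'" "y \<approx> y'" "z \<approx> z'" for x y z x' y' z'
    using that by (intro cong_diff cong_mult)
  show "e x y z = e x' y' z' \<longleftrightarrow> e y x (x * y - z) = e y' x' (x' * y' - z')"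
    using *[of x x' y y' z z'] *[of x x' y y' "x * y - z" "x' * y' - z'"]
    by (auto simp: e_eq_iff)
  show "e y x (x * y - z) \<otimes> e y' x' (x' * y' - z') =
      e (y + y') (x + x') ((x + x') * (y + y') - (z + z' + x * y'))"
    by (simp add: e_mult algebra_simps)
  have "x * y - z \<approx> 0 \<longleftrightarrow> z \<approx> 0" if "x \<approx> 0 \<or> y \<approx> 0"
  proof -
    have "x * y \<approx> 0" using that by (simp add: cong_mult_0_iff)
    then show ?thesis by (metis cong_diff_iff_cong_0 cong_sym_eq cong_trans)
  qed
  then show "e y x (x * y - z) \<in> S \<longleftrightarrow> e x y z \<in> S"
    by (auto simp: S_iff)
qed (use that in auto)

text \<open>Replacing \<open>a\<close> by \<open>a^i\<close> and \<open>b\<close> by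
  \<open>b^j\<close> forces \<open>c\<close> to become \<open>c^(i j)\<close>.\<close>

lemma diagonal_aut:
  assumes "\<not> i \<approx> 0" "\<not> j \<approx> 0"
  obtains f where "f \<in> graph_auts \<Gamma>" "\<And>x y z. f (e x y z) = e (i * x) (j * y) (i * j * z)"
proof (rule coordinate_auto_in_graph_auts[of "\<lambda>x y z. e (i * x) (j * y) (i * j * z)"])
  fix x y z x' y' z'
  have ij: "\<not> i * j \<approx> 0" using assms by (simp add: cong_mult_0_iff)
  show "e x y z = e x' y' z' \<longleftrightarrow> e (i * x) (j * y) (i * j * z) = e (i * x') (j * y') (i * j * z')"
    unfolding e_eq_iff by (simp only: cong_mult_cancel assms ij not_False_eq_True)
  show "e (i * x) (j * y) (i * j * z) \<otimes> e (i * x') (j * y') (i * j * z') =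
      e (i * (x + x')) (j * (y + y')) (i * j * (z + z' + x * y'))"
    by (simp add: e_mult algebra_simps)
  show "e (i * x) (j * y) (i * j * z) \<in> S \<longleftrightarrow> e x y z \<in> S"
    using assms ij by (simp add: S_iff cong_mult_0_iff)
qed (use that in auto)

section \<open>The stabilizer of the identity\<close>

lemma stabilizer_line_preserving:
  assumes f: "f \<in> graph_auts \<Gamma>" "f \<one> = \<one>"
    and al: "\<And>g h. g \<in> carrier G \<Longrightarrow> h \<in> carrier G \<Longrightarrow> (f g, f h) \<in> al \<longleftrightarrow> (g, h) \<in> al"
    and bl: "\<And>g h. g \<in> carrier G \<Longrightarrow> h \<in> carrier G \<Longrightarrow> (f g, f h) \<in> bl \<longleftrightarrow> (g, h) \<in> bl"
  shows "f \<in> hom G G" and "\<exists>y z. f (e 0 1 1) = e 0 y z"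
proof -
  have bij: "bij_betw f (carrier G) (carrier G)"
    using f(1) by (simp add: graph_auts_def Bij_def)
  from line_preserving_form[OF bij f(2) al bl]
  obtain A B H where f_e: "\<And>x y z. f (e x y z) = e (A x) (B y) (H z)"
    and A: "\<And>x x'. A (x + x') \<approx> A x + A x'" and B: "\<And>y y'. B (y + y') \<approx> B y + B y'"
    and H_mult: "\<And>z x y. H (z + x * y) \<approx> H z + A x * B y"
    and H: "\<And>z z'. H (z + z') \<approx> H z + H z'"
    by metis
  show "f \<in> hom G G"
  proof (rule homI)
    fix g h assume "g \<in> carrier G" "h \<in> carrier G"
    then obtain x y z x' y' z' where [simp]: "g = e x y z" "h = e x' y' z'"
      using carrier_cases by metis
    \<comment> \<open>Multiplicativity of \<open>f\<close> in the third coordinate is exactly this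
      compatibility with the cocycle.\<close>
    have "H (z + z' + x * y') \<approx> H z + H z' + A x * B y'"
      using H_mult[of "z + z'" x y'] cong_add[OF H[of z z'] cong_refl, of "A x * B y'"]
      by (rule cong_trans)
    then show "f (g \<otimes> h) = f g \<otimes> f h"
      by (simp add: e_mult f_e e_eq_iff A B)
  qed (use bij in \<open>auto simp: bij_betw_def\<close>)
  have "A 0 \<approx> 0"
    using f(2) unfolding one_eq f_e e_eq_iff by blast
  then show "\<exists>y z. f (e 0 1 1) = e 0 y z"
    unfolding f_e e_eq_iff by (meson cong_refl)
qed

text \<open>The image of the edge from the identity to \<open>a\<close> decides between preserving
  and exchanging the two types. The second conclusion is the obstruction to distance-transitivity: a
  zero among the first two coordinates of \<open>b c\<close> survives.\<close>

lemma stabilizer: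
  assumes f: "f \<in> graph_auts \<Gamma>" and f_one: "f \<one> = \<one>"
  shows "f \<in> hom G G" and "\<exists>y z. f (e 0 1 1) = e 0 y z \<or> f (e 0 1 1) = e y 0 z"
proof -
  have lines: "((f g, f h) \<in> r \<longleftrightarrow> (g, h) \<in> al) \<and> ((f g, f h) \<in> s \<longleftrightarrow> (g, h) \<in> bl)"
    if f: "f \<in> graph_auts \<Gamma>" and edge: "(f \<one>, f (e 1 0 0)) \<in> r"
      and rs: "(r, s) = (al, bl) \<or> (r, s) = (bl, al)" and gh: "g \<in> carrier G" "h \<in> carrier G" for f r s g h
  proof -
    have bij: "bij_betw f (carrier G) (carrier G)"
      using f by (simp add: graph_auts_def Bij_def)
    have f_closed: "f u \<in> carrier G" if "u \<in> carrier G" for u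
      using bij that by (auto simp: bij_betw_def)
    have refl: "(u, u) \<in> al" if "u \<in> carrier G" for u
      using that by (simp add: al_def)
    have "(f u, f v) \<in> r \<union> s \<longleftrightarrow> (u, v) \<in> al \<union> bl" if uv: "u \<in> carrier G" "v \<in> carrier G" for u v
    proof (cases "u = v")
      case True
      then show ?thesis using refl uv f_closed rs by auto
    next
      case False
      then have "f u \<noteq> f v" using bij uv by (auto simp: bij_betw_def inj_on_def)
      then show ?thesis
        using False graph_auts_arc_iff[OF f, of u v] arc_iff[OF f_closed f_closed, of u v] arc_iff[OF uv] uv rs
        by auto
    qed
    moreover have trans_dom: "transverse_equivs (carrier G) al bl"
      using equiv_al equiv_bl transverse by unfold_locales auto
    ultimately interpret transverse_equivs_map "carrier G" al bl r s f
      using bij rs transverse_equivs.transverse_equivs_swap[OF trans_dom]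
      by (auto simp: transverse_equivs_map_def transverse_equivs_map_axioms_def)
    have "(\<one>, e 1 0 0) \<in> al" "\<one> \<noteq> e 1 0 0"
      using one_not_cong_0 by (simp_all add: one_eq al_e_iff e_eq_iff cong_sym_eq)
    from preserved[OF this edge connected gh] show ?thesis by blast
  qed
  have "(f \<one>, f (e 1 0 0)) \<in> parcs \<Gamma>"
  proof -
    have "(\<one>, e 1 0 0) \<in> parcs \<Gamma>"
      using one_not_cong_0 by (simp add: arc_iff) (simp add: one_eq al_e_iff e_eq_iff cong_sym_eq)
    then show ?thesis using graph_auts_arc_iff[OF f] by simp
  qed
  then have "(f \<one>, f (e 1 0 0)) \<in> al \<or> (f \<one>, f (e 1 0 0)) \<in> bl"
    using arc_iff graph_auts_in_verts[OF f] by auto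
  then have "f \<in> hom G G \<and> (\<exists>y z. f (e 0 1 1) = e 0 y z \<or> f (e 0 1 1) = e y 0 z)"
  proof
    assume edge: "(f \<one>, f (e 1 0 0)) \<in> al"
    have "f \<in> hom G G" "\<exists>y z. f (e 0 1 1) = e 0 y z"
      by (rule stabilizer_line_preserving[OF f f_one]; use lines[OF f edge, of bl] in blast)+
    then show ?thesis by blast
  next
    assume edge: "(f \<one>, f (e 1 0 0)) \<in> bl"
    obtain \<sigma> where \<sigma>: "\<sigma> \<in> graph_auts \<Gamma>" "\<And>x y z. \<sigma> (e x y z) = e y x (x * y - z)"
      using swap_aut by blast
    define g where "g = compose (carrier G) \<sigma> f"
    have f_closed: "f u \<in> carrier G" if "u \<in> carrier G" for u
      using graph_auts_in_verts[OF f] that by simp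
    have g: "g \<in> graph_auts \<Gamma>"
      using graph_auts_compose[OF \<sigma>(1) f] by (simp add: g_def)
    have \<sigma>_bl: "(\<sigma> u, \<sigma> v) \<in> al \<longleftrightarrow> (u, v) \<in> bl" if "u \<in> carrier G" "v \<in> carrier G" for u v
    proof -
      obtain x y z where u: "u = e x y z" using \<open>u \<in> carrier G\<close> by (rule carrier_cases)
      obtain x' y' z' where v: "v = e x' y' z'" using \<open>v \<in> carrier G\<close> by (rule carrier_cases)
      show ?thesis
        unfolding u v \<sigma> al_e_iff bl_e_iff by (simp add: mult.commute cong_minus_minus_iff)
    qed
    have g_one: "g \<one> = \<one>"
      by (simp add: g_def compose_eq f_one) (simp add: one_eq \<sigma>)
    have "(g \<one>, g (e 1 0 0)) \<in> al"
      using edge \<sigma>_bl by (simp add: g_def compose_eq f_closed)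
    note g_lines = lines[OF g this, of bl]
    have *: "g \<in> hom G G" "\<exists>y z. g (e 0 1 1) = e 0 y z"
      by (rule stabilizer_line_preserving[OF g g_one]; use g_lines in blast)+
    \<comment> \<open>The swap is its own inverse, so \<open>f\<close> is recovered from
      \<open>g\<close>.\<close>
    have f_eq: "f u = \<sigma> (g u)" if u: "u \<in> carrier G" for u
    proof -
      obtain x y z where "f u = e x y z" using f_closed[OF u] by (rule carrier_cases)
      then show ?thesis using that by (simp add: g_def compose_eq \<sigma> mult.commute)
    qed
    have \<sigma>_hom: "\<sigma> \<in> hom G G"
    proof (rule homI)
      fix g h assume "g \<in> carrier G" "h \<in> carrier G"
      then obtain x y z x' y' z' where "g = e x y z" "h = e x' y' z'" using carrier_cases by metis
      then show "\<sigma> (g \<otimes> h) = \<sigma> g \<otimes> \<sigma> h" by (simp add: e_mult \<sigma> algebra_simps)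
    qed (use graph_auts_in_verts[OF \<sigma>(1)] in simp)
    have "f \<in> hom G G"
    proof (rule homI)
      fix u v assume "u \<in> carrier G" "v \<in> carrier G"
      then show "f (u \<otimes> v) = f u \<otimes> f v"
        using hom_mult[OF *(1)] hom_mult[OF \<sigma>_hom] hom_in_carrier[OF *(1)] by (simp add: f_eq)
    qed (rule f_closed)
    moreover obtain y z where "g (e 0 1 1) = e 0 y z" using *(2) by blast
    then have "f (e 0 1 1) = e y 0 (- z)" by (simp add: f_eq \<sigma>)
    ultimately show ?thesis by blast
  qed
  then show "f \<in> hom G G" and "\<exists>y z. f (e 0 1 1) = e 0 y z \<or> f (e 0 1 1) = e y 0 z" by auto
qed

lemma normal_cayley: "normal_cayley_graph G S"
  by (rule normal_cayley_graphI[OF connection_set_S stabilizer(1)])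

lemma diagonal_swap_aut:
  assumes "\<not> i \<approx> 0" "\<not> j \<approx> 0"
  obtains f where "f \<in> graph_auts \<Gamma>" "\<And>x y z. f (e x y z) = e (i * y) (j * x) (i * j * (x * y - z))"
proof -
  obtain \<sigma> where \<sigma>: "\<sigma> \<in> graph_auts \<Gamma>" "\<And>x y z. \<sigma> (e x y z) = e y x (x * y - z)"
    using swap_aut by blast
  obtain h where h: "h \<in> graph_auts \<Gamma>" "\<And>x y z. h (e x y z) = e (i * x) (j * y) (i * j * z)"
    using diagonal_aut[OF assms] by blast
  show thesis
    using graph_auts_compose[OF h(1) \<sigma>(1)]
    by (rule that) (simp add: compose_eq \<sigma> h)
qed

section \<open>Short walks and spheres around the identity\<close>

lemma arc_e_iff:
  "(e x y z, e x' y' z') \<in> parcs \<Gamma> \<longleftrightarrow>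
    (y \<approx> y' \<and> z - x * y \<approx> z' - x' * y' \<or> x \<approx> x' \<and> z \<approx> z') \<and>
    \<not> (x \<approx> x' \<and> y \<approx> y' \<and> z \<approx> z')"
  by (simp add: arc_iff al_e_iff bl_e_iff e_eq_iff)

lemma one_arc_cases:
  assumes "(\<one>, g) \<in> parcs \<Gamma>"
  obtains i where "\<not> i \<approx> 0" "g = e i 0 0" | i where "\<not> i \<approx> 0" "g = e 0 i 0"
proof -
  have "g \<in> S" using assms by (auto simp: cayley_graph_def)
  then show thesis using that by (auto simp: S_def)
qed

lemma dist_one_iff:
  "graph_dist \<Gamma> \<one> g = ereal (real n) \<longleftrightarrow>
    (\<one>, g) \<in> parcs \<Gamma> ^^ n \<and> (\<forall>m<n. (\<one>, g) \<notin> parcs \<Gamma> ^^ m)"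
proof -
  interpret pair_graph \<Gamma> by (rule pair_graph)
  show ?thesis by (rule graph_dist_eq_iff[OF pair_wf_digraph]) simp
qed

text \<open>Steps multiply on the left. Two steps in one direction stay on a line through the
  identity; mixed steps give \<open>b^j a^i\<close> or \<open>a^i b^j\<close>, and the latter equals
  \<open>b^j a^i c^(i j)\<close>.\<close>

lemma two_arcs_cases:
  assumes "(\<one>, g) \<in> parcs \<Gamma> ^^ 2"
  obtains i where "g = e i 0 0" | i where "g = e 0 i 0"
    | i j where "\<not> i \<approx> 0" "\<not> j \<approx> 0" "g = e i j 0"
    | i j where "\<not> i \<approx> 0" "\<not> j \<approx> 0" "g = e i j (i * j)"
proof -
  obtain h where h: "(\<one>, h) \<in> parcs \<Gamma>" and hg: "(h, g) \<in> parcs \<Gamma>"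
    using assms by (auto simp: numeral_2_eq_2)
  then have "g \<in> carrier G" by (auto simp: cayley_graph_def)
  then obtain x y z where g: "g = e x y z" by (rule carrier_cases)
  from h show thesis
  proof (cases rule: one_arc_cases)
    case (1 i)
    then consider "0 \<approx> y" "0 \<approx> z - x * y" | "i \<approx> x" "0 \<approx> z" "\<not> 0 \<approx> y"
      using hg unfolding g by (auto simp: arc_e_iff)
    then show thesis
    proof cases
      case 1
      from 1(1) have "y \<approx> 0" by (rule cong_sym)
      then have "x * y \<approx> 0" by (simp add: cong_mult_0_iff)
      from cong_add[OF cong_sym[OF 1(2)] this] have "z \<approx> 0" by simp
      then have "g = e x 0 0"
        using \<open>y \<approx> 0\<close> unfolding g e_eq_iff by simp
      then show thesis using that by blast
    next
      case 2
      then have "g = e i y 0" "\<not> y \<approx> 0"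
        unfolding g e_eq_iff using cong_sym by (blast intro: cong_refl)+
      then show thesis using that 1 by blast
    qed
  next
    case (2 i)
    then consider "0 \<approx> x" "0 \<approx> z" | "i \<approx> y" "0 \<approx> z - x * y" "\<not> 0 \<approx> x"
    proof -
      have "0 \<approx> z" if "0 \<approx> x" "0 \<approx> z - x * y"
      proof -
        have "0 \<approx> x * y" using cong_mult[OF that(1) cong_refl, of y] by simp
        from cong_add[OF that(2) this] show ?thesis by simp
      qed
      then show thesis
        using hg that cong_sym unfolding g 2(2) arc_e_iff mult_zero_left diff_zero by blast
    qed
    then show thesis
    proof cases
      case 1
      then have "g = e 0 y 0"
        unfolding g e_eq_iff using cong_sym by (blast intro: cong_refl)
      then show thesis using that by blast
    next
      case 2
      have "z \<approx> x * y"
        using cong_add[OF cong_sym[OF 2(2)] cong_refl, of "x * y"] by simp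
      also have "x * y \<approx> x * i"
        using 2(1) by (intro cong_mult cong_refl) (rule cong_sym)
      finally have "g = e x i (x * i)" "\<not> x \<approx> 0"
        using 2 unfolding g e_eq_iff using cong_sym by (blast intro: cong_refl)+
      then show thesis using that \<open>\<not> i \<approx> 0\<close> by blast
    qed
  qed
qed

text \<open>The base elements are \<open>a\<close> and \<open>b a\<close>. Diagonal maps send
  \<open>b a\<close> to the elements \<open>e k l 0\<close>; composing with the swap, which sends
  \<open>b a\<close> to \<open>a b\<close>, gives the elements \<open>e k l (k * l)\<close>.\<close>

lemma two_distance_transitive: "t_distance_transitive 2 \<Gamma>"
proof (rule cayley_t_distance_transitiveI[OF connection_set_S])
  note unit = one_not_cong_0
  fix i :: nat
  assume "i \<in> {1..2}"
  then consider "i = 1" | "i = 2" by fastforce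
  then show "\<exists>w\<in>carrier G. \<forall>v\<in>carrier G. graph_dist \<Gamma> \<one> v = ereal (real i) \<longrightarrow>
      (\<exists>f\<in>graph_auts \<Gamma>. f \<one> = \<one> \<and> f w = v)"
  proof cases
    case 1
    have "\<exists>f\<in>graph_auts \<Gamma>. f \<one> = \<one> \<and> f (e 1 0 0) = v" if "graph_dist \<Gamma> \<one> v = ereal (real i)" for v
    proof -
      have "(\<one>, v) \<in> parcs \<Gamma>" using that unfolding 1 dist_one_iff by simp
      then show ?thesis
      proof (cases rule: one_arc_cases)
        case (1 k)
        obtain f where "f \<in> graph_auts \<Gamma>" "\<And>x y z. f (e x y z) = e (k * x) (1 * y) (k * 1 * z)"
          using diagonal_aut[OF 1(1) unit] by blast
        then show ?thesis by (intro bexI[of _ f]) (simp_all add: one_eq 1)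
      next
        case (2 k)
        obtain f where "f \<in> graph_auts \<Gamma>" "\<And>x y z. f (e x y z) = e (1 * y) (k * x) (1 * k * (x * y - z))"
          using diagonal_swap_aut[OF unit 2(1)] by blast
        then show ?thesis by (intro bexI[of _ f]) (simp_all add: one_eq 2)
      qed
    qed
    then show ?thesis by (intro bexI[of _ "e 1 0 0"]) auto
  next
    case 2
    have "\<exists>f\<in>graph_auts \<Gamma>. f \<one> = \<one> \<and> f (e 1 1 0) = v" if "graph_dist \<Gamma> \<one> v = ereal (real i)" for v
    proof -
      have v: "(\<one>, v) \<in> parcs \<Gamma> ^^ 2" and short: "\<And>m. m < 2 \<Longrightarrow> (\<one>, v) \<notin> parcs \<Gamma> ^^ m"
        using that unfolding 2 dist_one_iff by auto
      have not_line: "v \<noteq> \<one>" "(\<one>, v) \<notin> parcs \<Gamma>" using short[of 0] short[of 1] by auto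
      from v show ?thesis
      proof (cases rule: two_arcs_cases)
        case (1 k)
        then show ?thesis using not_line cong_sym[of 0 k] by (auto simp: one_eq e_eq_iff arc_e_iff)
      next
        case (2 k)
        then show ?thesis using not_line cong_sym[of 0 k] by (auto simp: one_eq e_eq_iff arc_e_iff)
      next
        case (3 k l)
        obtain f where "f \<in> graph_auts \<Gamma>" "\<And>x y z. f (e x y z) = e (k * x) (l * y) (k * l * z)"
          using diagonal_aut[OF 3(1,2)] by blast
        then show ?thesis by (intro bexI[of _ f]) (simp_all add: one_eq 3)
      next
        case (4 k l)
        obtain f where "f \<in> graph_auts \<Gamma>" "\<And>x y z. f (e x y z) = e (k * y) (l * x) (k * l * (x * y - z))"
          using diagonal_swap_aut[OF 4(1,2)] by blast
        then show ?thesis by (intro bexI[of _ f]) (simp_all add: one_eq 4)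
      qed
    qed
    then show ?thesis by (intro bexI[of _ "e 1 1 0"]) auto
  qed
qed

lemma two_not_cong_0: "\<not> 2 \<approx> 0"
proof
  assume "2 \<approx> 0"
  then have "p dvd 2"
    using int_dvd_int_iff[of p 2] by (simp add: cong_0_iff)
  then have "p = 2"
    using primes_dvd_imp_eq[OF prime_p two_is_prime_nat] by simp
  then show False using odd_p by simp
qed

text \<open>
  Both \<open>b c\<close> and \<open>b a c\<^sup>-\<^sup>1\<close> have distance 3 from the identity, but an automorphism fixing the
  identity maps elements with \<open>x y = 0\<close> to elements with \<open>x y = 0\<close>.
\<close>

lemma not_distance_transitive: "\<not> distance_transitive \<Gamma>"
proof
  assume trans: "distance_transitive \<Gamma>"
  have unit: "\<not> 1 \<approx> 0" "\<not> 0 \<approx> 1" "\<not> 0 \<approx> 2" "\<not> 2 \<approx> 0" "\<not> - 1 \<approx> 0" "\<not> 0 \<approx> - 1"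
    using one_not_cong_0 two_not_cong_0 cong_minus_minus_iff[of 1 0 "int p"] cong_sym[of _ _ "int p"]
    by auto
  \<comment> \<open>A necessary condition for distance at most 2; violating it suffices for distance
    3 once a walk of length 3 is given.\<close>
  have two: "z \<approx> 0 \<or> z \<approx> x * y" if "(\<one>, e x y z) \<in> parcs \<Gamma> ^^ m" "m < 3" for m x y z
  proof -
    consider "m = 0" | "m = 1" | "m = 2" using \<open>m < 3\<close> by linarith
    then show ?thesis
    proof cases
      case 1
      then show ?thesis using that cong_sym[of 0 z] by (simp add: one_eq e_eq_iff)
    next
      case 2
      then have "(\<one>, e x y z) \<in> parcs \<Gamma>" using that by simp
      then show ?thesis by (cases rule: one_arc_cases) (simp_all add: e_eq_iff)
    next
      case 3
      then have "(\<one>, e x y z) \<in> parcs \<Gamma> ^^ 2" using that by simp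
      then show ?thesis
        by (cases rule: two_arcs_cases)
          (auto simp: e_eq_iff intro: cong_trans[OF _ cong_sym[OF cong_mult]])
    qed
  qed
  have three: "graph_dist \<Gamma> \<one> (e x y z) = ereal (real 3)"
    if "(\<one>, g) \<in> parcs \<Gamma>" "(g, h) \<in> parcs \<Gamma>" "(h, e x y z) \<in> parcs \<Gamma>" "\<not> z \<approx> 0" "\<not> z \<approx> x * y"
    for g h x y z
    using that two unfolding dist_one_iff by (auto simp: numeral_3_eq_3)
  have "graph_dist \<Gamma> \<one> (e 0 1 1) = ereal (real 3)"
    \<comment> \<open>The walk spells \<open>b c = a b a^-1\<close>.\<close>
    by (rule three[of "e (- 1) 0 0" "e (- 1) 1 0"]) (use unit in \<open>simp_all add: one_eq arc_e_iff\<close>)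
  moreover have "graph_dist \<Gamma> \<one> (e 1 1 (- 1)) = ereal (real 3)"
  \<comment> \<open>The walk spells \<open>a^-1 b a^2\<close>; at height 1 the value
    \<open>z - x y = -2\<close> is kept, so \<open>x = 1\<close> gives
    \<open>z = -1\<close>.\<close>
  proof (rule three[of "e 2 0 0" "e 2 1 0"])
    have "\<not> - 1 \<approx> 1" using unit(3) cong_add_rcancel[of "- 1" 1 1 "int p"] by simp
    then show "\<not> - 1 \<approx> 1 * 1" by simp
  qed (use unit in \<open>simp_all add: one_eq arc_e_iff\<close>)
  ultimately obtain f where f: "f \<in> graph_auts \<Gamma>" "f \<one> = \<one>" "f (e 0 1 1) = e 1 1 (- 1)"
    using trans unfolding distance_transitive_def by (metis verts e_closed one_closed)
  then obtain y z where "e 1 1 (- 1) = e 0 y z \<or> e 1 1 (- 1) = e y 0 z"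
    using stabilizer(2)[OF f(1,2)] by auto
  then show False using unit by (auto simp: e_eq_iff)
qed

text \<open>With the identity in the middle, a 2-arc from \<open>a\<close> to \<open>a^2\<close> has
  adjacent ends, being part of a triangle on one line, while the one from \<open>a\<close> to
  \<open>b\<close> does not.\<close>

lemma not_two_arc_transitive: "\<not> s_arc_transitive 2 \<Gamma>"
proof
  assume trans: "s_arc_transitive 2 \<Gamma>"
  have unit: "\<not> 1 \<approx> 0" "\<not> 0 \<approx> 1" "\<not> 0 \<approx> 2" "\<not> 2 \<approx> 0"
    using one_not_cong_0 two_not_cong_0 cong_sym[of _ _ "int p"] by auto
  have "\<not> 1 \<approx> 2" "\<not> 2 \<approx> 1"
    using unit(1,2) cong_add_rcancel[of 0 1 1 "int p"] cong_add_rcancel[of 1 1 0 "int p"] by auto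
  note unit = unit this
  have arcs: "[u, v, w] \<in> s_arcs 2 \<Gamma> \<longleftrightarrow> {u, v, w} \<subseteq> carrier G \<and>
      (u, v) \<in> parcs \<Gamma> \<and> (v, w) \<in> parcs \<Gamma> \<and> u \<noteq> w" for u v w
  proof -
    have "{1..2::nat} = {1, 2}" "{1..2 - 1::nat} = {1}" by auto
    then show ?thesis by (auto simp: s_arcs_def numeral_2_eq_2)
  qed
  have "[e 1 0 0, \<one>, e 2 0 0] \<in> s_arcs 2 \<Gamma>" "[e 1 0 0, \<one>, e 0 1 0] \<in> s_arcs 2 \<Gamma>"
    using unit by (simp_all add: arcs one_eq arc_e_iff e_eq_iff)
  then obtain f where f: "f \<in> graph_auts \<Gamma>" and "map f [e 1 0 0, \<one>, e 2 0 0] = [e 1 0 0, \<one>, e 0 1 0]"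
    using trans unfolding s_arc_transitive_def by blast
  then have "(e 1 0 0, e 2 0 0) \<in> parcs \<Gamma> \<longleftrightarrow> (e 1 0 0, e 0 1 0) \<in> parcs \<Gamma>"
    using graph_auts_arc_iff[OF f, of "e 1 0 0" "e 2 0 0"] by simp
  then show False using unit by (simp add: arc_e_iff)
qed

end

theorem theorem1p2:
  fixes p :: nat
  assumes "prime p" and "odd p"
  shows "normal_cayley_graph (heis_group p) (heis_connection_set p)
    \<and> t_distance_transitive 2 (cayley_graph (heis_group p) (heis_connection_set p))
    \<and> \<not> distance_transitive (cayley_graph (heis_group p) (heis_connection_set p))
    \<and> \<not> s_arc_transitive 2 (cayley_graph (heis_group p) (heis_connection_set p))"
proof -
  obtain e where e: "heis_coordinates (heis_group p) p e"
    and S: "heis_connection_set p =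
      {e i 0 0 |i. \<not> [i = 0] (mod int p)} \<union> {e 0 i 0 |i. \<not> [i = 0] (mod int p)}"
    by (rule heis_group_coordinates[OF assms])
  interpret heis_coordinates "heis_group p" p e by (rule e)
  show ?thesis
    unfolding S S_def[symmetric]
    using normal_cayley two_distance_transitive not_distance_transitive not_two_arc_transitive
    by blast
qed

end
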